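(* Let $I_{c,n}^{(s)}:=\max\{I(K): K\text{ is a centrally symmetric cap body in }\mathbb{E}^n\}$. Then, as $n\to\infty$, $$I_{c,n}^{(s)}\ge \left(\frac{2}{\sqrt{3}}-o(1)\right)^n.$$
   Context: $\mathbb{E}^n$ is $n$-dimensional Euclidean space, $\mathbb{B}^n$ its closed unit ball and $\mathbb{S}^{n-1}$ its unit sphere. For a compact $K\subset\mathbb{E}^n$, a boundary point $x$ of $K$ is illuminated by a direction $u\in\mathbb{S}^{n-1}$ if the half line originating at $x$ in the direction of $u$ intersects the interior of $K$ at points arbitrarily close to $x$. The illumination number $I(K)$ is the smallest number of directions needed to illuminate all boundary points of $K$ (each boundary point is illuminated by at least one of the directions). For points $x_1,\dots,x_m\in\mathbb{E}^n\setminus\mathbb{B}^n$ the spiky ball is $$\mathrm{Sp}[x_1,\dots,x_m]:=\bigcup_{i=1}^m \mathrm{conv}(\mathbb{B}^n\cup\{x_i\}),$$ where $\mathrm{conv}$ is the convex hull; it is always assumed (without loss of generality) that each $x_i$ is a vertex, i.e., $\mathrm{Sp}[x_1,\dots,x_m]\neq \mathrm{Sp}[x_1,\dots,x_{i-1},x_{i+1},\dots,x_m]$. A cap body is a spiky ball which is a convex body (convex compact set with non-empty interior). The term $o(1)$ depends only on $n$ and tends to $0$ as $n\to\infty$. *)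

theory Defs
  imports "HOL-Analysis.Analysis" "HOL-Library.Extended_Nat" "HOL-Library.Landau_Symbols"
begin

section \<open>Euclidean spaces of varying dimension\<close>

text \<open>
  The dimension has to be a natural number that is quantified inside the statement, so it cannot be
  a type. All the spaces are therefore embedded in one inner product space, the finitely supported
  real sequences, in which \<open>Esp n\<close> consists of the sequences supported on the first \<open>n\<close> indices.
\<close>

typedef fseq = "{f :: nat \<Rightarrow> real. finite {i. f i \<noteq> 0}}"
  morphisms coord Abs_fseq
  by (rule exI[of _ "\<lambda>_. 0"]) simp

setup_lifting type_definition_fseq

lemma finite_support [simp]: "finite {i. coord x i \<noteq> 0}"
  using coord by simp

lemma fseq_eqI: "(\<And>i. coord x i = coord y i) \<Longrightarrow> x = y"
  by (simp add: coord_inject[symmetric] fun_eq_iff)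

instantiation fseq :: real_vector
begin

lift_definition zero_fseq :: fseq is "\<lambda>_. 0" by simp

lift_definition plus_fseq :: "fseq \<Rightarrow> fseq \<Rightarrow> fseq" is "\<lambda>f g i. f i + g i"
proof -
  fix f g :: "nat \<Rightarrow> real"
  assume "finite {i. f i \<noteq> 0}" "finite {i. g i \<noteq> 0}"
  then show "finite {i. f i + g i \<noteq> 0}"
    by (rule finite_subset[OF _ finite_UnI, rotated]) auto
qed

lift_definition minus_fseq :: "fseq \<Rightarrow> fseq \<Rightarrow> fseq" is "\<lambda>f g i. f i - g i"
proof -
  fix f g :: "nat \<Rightarrow> real"
  assume "finite {i. f i \<noteq> 0}" "finite {i. g i \<noteq> 0}"
  then show "finite {i. f i - g i \<noteq> 0}"
    by (rule finite_subset[OF _ finite_UnI, rotated]) auto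
qed

lift_definition uminus_fseq :: "fseq \<Rightarrow> fseq" is "\<lambda>f i. - f i" by simp

lift_definition scaleR_fseq :: "real \<Rightarrow> fseq \<Rightarrow> fseq" is "\<lambda>r f i. r * f i"
  by (erule rev_finite_subset) auto

instance
  by standard (transfer; simp add: fun_eq_iff algebra_simps)+

end

lemma coord_simps [simp]:
  "coord 0 i = 0"
  "coord (x + y) i = coord x i + coord y i"
  "coord (x - y) i = coord x i - coord y i"
  "coord (- x) i = - coord x i"
  "coord (r *\<^sub>R x) i = r * coord x i"
  by (transfer; simp)+

instantiation fseq :: real_inner
begin

definition inner_fseq :: "fseq \<Rightarrow> fseq \<Rightarrow> real" where
  "inner_fseq x y = (\<Sum>i | coord x i \<noteq> 0. coord x i * coord y i)"

definition norm_fseq :: "fseq \<Rightarrow> real" where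
  "norm_fseq x = sqrt (inner x x)"

definition dist_fseq :: "fseq \<Rightarrow> fseq \<Rightarrow> real" where
  "dist_fseq x y = norm (x - y)"

definition sgn_fseq :: "fseq \<Rightarrow> fseq" where
  "sgn_fseq x = x /\<^sub>R norm x"

definition uniformity_fseq :: "(fseq \<times> fseq) filter" where
  "uniformity_fseq = (INF e\<in>{0<..}. principal {(x, y). dist x y < e})"

definition open_fseq :: "fseq set \<Rightarrow> bool" where
  "open_fseq U \<longleftrightarrow> (\<forall>x\<in>U. \<forall>\<^sub>F (x', y) in uniformity. x' = x \<longrightarrow> y \<in> U)"

lemma inner_fseq_superset:
  assumes "finite A" "{i. coord x i \<noteq> 0} \<subseteq> A"
  shows "inner x y = (\<Sum>i\<in>A. coord x i * coord y i)"
  unfolding inner_fseq_def using assms by (intro sum.mono_neutral_left) auto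

instance
proof
  fix x y z :: fseq and r :: real and U :: "fseq set"
  let ?A = "{i. coord x i \<noteq> 0} \<union> {i. coord y i \<noteq> 0}"
  have A: "finite ?A" by simp
  show "dist x y = norm (x - y)" by (rule dist_fseq_def)
  show "sgn x = x /\<^sub>R norm x" by (rule sgn_fseq_def)
  show "uniformity = (INF e\<in>{0<..}. principal {(x, y::fseq). dist x y < e})"
    by (rule uniformity_fseq_def)
  show "open U \<longleftrightarrow> (\<forall>x\<in>U. \<forall>\<^sub>F (x', y) in uniformity. x' = x \<longrightarrow> y \<in> U)"
    by (rule open_fseq_def)
  show "norm x = sqrt (inner x x)" by (rule norm_fseq_def)
  have "inner x y = (\<Sum>i\<in>?A. coord x i * coord y i)" by (rule inner_fseq_superset) auto
  moreover have "inner y x = (\<Sum>i\<in>?A. coord y i * coord x i)" by (rule inner_fseq_superset) auto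
  ultimately show "inner x y = inner y x" by (simp add: mult.commute)
  have "inner (x + y) z = (\<Sum>i\<in>?A. coord (x + y) i * coord z i)"
    by (rule inner_fseq_superset) auto
  moreover have "inner x z = (\<Sum>i\<in>?A. coord x i * coord z i)" by (rule inner_fseq_superset) auto
  moreover have "inner y z = (\<Sum>i\<in>?A. coord y i * coord z i)" by (rule inner_fseq_superset) auto
  ultimately show "inner (x + y) z = inner x z + inner y z"
    by (simp add: distrib_right sum.distrib)
  have "inner (r *\<^sub>R x) y = (\<Sum>i\<in>?A. coord (r *\<^sub>R x) i * coord y i)"
    by (rule inner_fseq_superset) auto
  moreover have "inner x y = (\<Sum>i\<in>?A. coord x i * coord y i)" by (rule inner_fseq_superset) auto
  ultimately show "inner (r *\<^sub>R x) y = r * inner x y"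
    by (simp add: sum_distrib_left mult.assoc)
  show "0 \<le> inner x x" by (simp add: inner_fseq_def sum_nonneg)
  show "inner x x = 0 \<longleftrightarrow> x = 0"
  proof
    assume "inner x x = 0"
    then have "\<forall>i\<in>{i. coord x i \<noteq> 0}. coord x i * coord x i = 0"
      unfolding inner_fseq_def by (subst (asm) sum_nonneg_eq_0_iff) auto
    then show "x = 0" by (intro fseq_eqI) auto
  qed (simp add: inner_fseq_def)
qed

end

definition Esp :: "nat \<Rightarrow> fseq set" where
  "Esp n = {x. \<forall>i\<ge>n. coord x i = 0}"

lemma subspace_Esp: "subspace (Esp n)"
  by (auto simp: subspace_def Esp_def)

lemma inner_Esp:
  assumes "x \<in> Esp n"
  shows "inner x y = (\<Sum>i<n. coord x i * coord y i)"
  using assms by (intro inner_fseq_superset) (auto simp: Esp_def not_le[symmetric])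

lemma norm_Esp: "x \<in> Esp n \<Longrightarrow> norm x = L2_set (coord x) {..<n}"
  by (simp add: norm_eq_sqrt_inner inner_Esp L2_set_def power2_eq_square)

lemma coord_image_Esp: "coord ` Esp n = topspace (Euclidean_space n)"
proof (intro equalityI subsetI)
  fix f assume "f \<in> topspace (Euclidean_space n)"
  then have f: "\<forall>i\<ge>n. f i = 0" by (simp add: topspace_Euclidean_space)
  then have "{i. f i \<noteq> 0} \<subseteq> {..<n}" by (auto simp: not_le[symmetric])
  then have "coord (Abs_fseq f) = f"
    by (intro Abs_fseq_inverse) (auto intro: finite_subset)
  with f show "f \<in> coord ` Esp n"
    by (intro image_eqI[of _ _ "Abs_fseq f"]) (auto simp: Esp_def)
qed (auto simp: Esp_def topspace_Euclidean_space)

definition unit_ball :: "nat \<Rightarrow> fseq set" where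
  "unit_ball n = cball 0 1 \<inter> Esp n"

text \<open>The unit sphere \<open>S\<^sup>n\<^sup>-\<^sup>1\<close>, indexed by the dimension of the ambient space.\<close>

definition unit_sphere :: "nat \<Rightarrow> fseq set" where
  "unit_sphere n = sphere 0 1 \<inter> Esp n"

text \<open>Interior and boundary are taken relative to \<open>Esp n\<close>, not in the surrounding sequence space.\<close>

definition Eint :: "nat \<Rightarrow> fseq set \<Rightarrow> fseq set" where
  "Eint n K = top_of_set (Esp n) interior_of K"

definition Ebd :: "nat \<Rightarrow> fseq set \<Rightarrow> fseq set" where
  "Ebd n K = top_of_set (Esp n) frontier_of K"

section \<open>Illumination\<close>

definition half_line :: "fseq \<Rightarrow> fseq \<Rightarrow> fseq set" where
  "half_line x u = {x + t *\<^sub>R u | t. t \<ge> 0}"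

definition illuminates :: "nat \<Rightarrow> fseq set \<Rightarrow> fseq \<Rightarrow> fseq \<Rightarrow> bool" where
  "illuminates n K u x \<longleftrightarrow> (\<forall>\<epsilon>>0. \<exists>y \<in> half_line x u \<inter> Eint n K. dist x y < \<epsilon>)"

text \<open>The value is \<open>\<infinity>\<close> if no finite set of directions illuminates \<open>K\<close>.\<close>

definition illumination_number :: "nat \<Rightarrow> fseq set \<Rightarrow> enat" where
  "illumination_number n K =
     (INF D \<in> {D. finite D \<and> D \<subseteq> unit_sphere n \<and>
                  (\<forall>x \<in> Ebd n K. \<exists>u\<in>D. illuminates n K u x)}. enat (card D))"

section \<open>Spiky balls and cap bodies\<close>

definition spiky_ball :: "nat \<Rightarrow> fseq set \<Rightarrow> fseq set" where
  "spiky_ball n X = (\<Union>x\<in>X. convex hull (unit_ball n \<union> {x}))"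

text \<open>
  The points are collected in a finite set instead of a list: a list with a repeated entry violates
  the requirement that no point can be dropped.
\<close>

definition is_spiky_ball :: "nat \<Rightarrow> fseq set \<Rightarrow> bool" where
  "is_spiky_ball n K \<longleftrightarrow>
     (\<exists>X. finite X \<and> X \<noteq> {} \<and> X \<subseteq> Esp n - unit_ball n \<and>
          (\<forall>x\<in>X. spiky_ball n X \<noteq> spiky_ball n (X - {x})) \<and> K = spiky_ball n X)"

definition convex_body :: "nat \<Rightarrow> fseq set \<Rightarrow> bool" where
  "convex_body n K \<longleftrightarrow> K \<subseteq> Esp n \<and> convex K \<and> compact K \<and> Eint n K \<noteq> {}"

definition cap_body :: "nat \<Rightarrow> fseq set \<Rightarrow> bool" where
  "cap_body n K \<longleftrightarrow> is_spiky_ball n K \<and> convex_body n K"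

definition centrally_symmetric :: "nat \<Rightarrow> fseq set \<Rightarrow> bool" where
  "centrally_symmetric n K \<longleftrightarrow> (\<exists>c \<in> Esp n. (\<lambda>x. 2 *\<^sub>R c - x) ` K = K)"

text \<open>
  For \<open>n \<ge> 1\<close> the set of values is finite and nonempty, so that \<open>Max\<close> is a genuine maximum. (Points
  of norm at most \<open>2\<close> are illuminated by a sufficiently fine finite net of directions; convexity
  forces segments between distinct vertices to meet the unit ball, so that vertices of norm greater
  than \<open>2\<close> make pairwise angles of more than 120 degrees and their number is bounded, and the points
  of each such spike outside the unit ball are illuminated by one direction.)
\<close>

definition max_illumination_sym_cap :: "nat \<Rightarrow> enat" where
  "max_illumination_sym_cap n =
     Max (illumination_number n ` {K. cap_body n K \<and> centrally_symmetric n K})"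

end

theory Submission
  imports Defs "HOL-Real_Asymp.Real_Asymp"
begin

text \<open>
  Let \<open>U\<close> be a finite symmetric set of unit vectors with pairwise angles at least 60 degrees, and put
  a vertex at \<open>2 / sqrt 3\<close> times each of its points. The midpoint of any two distinct vertices then lies
  in the unit ball, which makes the spiky ball convex (\<open>convex_body_of_separated\<close>), so it is a
  centrally symmetric cap body. A direction \<open>v\<close> illuminates the vertex over \<open>u\<close> only if the angle
  between \<open>v\<close> and \<open>- u\<close> is at most 60 degrees (\<open>direction_illuminating_vertex\<close>). Hence the
  illumination number exceeds \<open>k\<close> if no \<open>k\<close> spherical caps of angular radius 60 degrees cover \<open>U\<close>.

  Such caps are small: their relative measure is about \<open>(sqrt 3 / 2) ^ n\<close>. For a set of random
  points, being covered by \<open>k\<close> given caps is therefore unlikely as long as \<open>k\<close> is a little smaller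
  than \<open>(2 / sqrt 3) ^ n\<close>, and up to a small perturbation of the radius the centres of the caps can be
  restricted to a net, so that only finitely many \<open>k\<close>-tuples of caps, at most \<open>2 ^ (n\<^sup>2 * k)\<close> of them,
  have to be defeated. This is carried out by the method of conditional expectations: a new point
  can be chosen at angle at least 60 degrees from the lines through the previous points and such that
  at least half of the surviving tuples fail to cover it (\<open>exists_separated_set_escaping_family\<close>).
  After \<open>n\<^sup>2 * k + 1\<close> steps no tuple covers all points
  (\<open>exists_separated_points_without_small_cover\<close>), and \<open>U\<close> consists of these points and their antipodes. Both requirements on the new point exclude little
  measure if \<open>(n\<^sup>2 * k + 1) * (sqrt 3 / 2) ^ n\<close> is small, which is where the base \<open>2 / sqrt 3\<close> arises.

  Measures of caps are estimated by volumes. Points are taken from the thin outer shell of the unit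
  ball and normalised, and the part of the ball above height \<open>c\<close> in some direction lies in a ball of
  radius \<open>sqrt (1 - c\<^sup>2)\<close>, so its relative volume is at most \<open>sqrt (1 - c\<^sup>2) ^ n\<close>
  (\<open>measure_cap_vol_le\<close>).

  The quantity \<open>max_illumination_sym_cap n\<close> is the maximum of a set that also has to be shown finite.
  In a fixed dimension the illumination numbers of cap bodies are bounded
  (\<open>illumination_number_cap_body_bounded\<close>): a fine net of directions illuminates all points of norm at
  most 2, and one direction suffices for all points outside the ball in the cap of a longer vertex.
  There are at most two such vertices, because segments between vertices meet the ball and so long
  vertices form angles of more than 120 degrees.
\<close>

section \<open>The unit ball of \<open>Esp n\<close>\<close>

lemma convex_unit_ball: "convex (unit_ball n)"
  unfolding unit_ball_def by (intro convex_Int convex_cball subspace_imp_convex subspace_Esp)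

lemma unit_ball_iff: "b \<in> unit_ball n \<longleftrightarrow> norm b \<le> 1 \<and> b \<in> Esp n"
  by (auto simp: unit_ball_def)

lemma unit_sphere_iff: "u \<in> unit_sphere n \<longleftrightarrow> norm u = 1 \<and> u \<in> Esp n"
  by (auto simp: unit_sphere_def)

lemma zero_in_unit_ball: "0 \<in> unit_ball n"
  by (simp add: unit_ball_iff subspace_0[OF subspace_Esp])

lemma Esp_closed_intros:
  "x \<in> Esp n \<Longrightarrow> y \<in> Esp n \<Longrightarrow> x + y \<in> Esp n"
  "x \<in> Esp n \<Longrightarrow> y \<in> Esp n \<Longrightarrow> x - y \<in> Esp n"
  "x \<in> Esp n \<Longrightarrow> r *\<^sub>R x \<in> Esp n"
  "x \<in> Esp n \<Longrightarrow> - x \<in> Esp n"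
  by (auto simp: Esp_def)

lemma minus_sgn_in_unit_sphere: "x \<in> Esp n \<Longrightarrow> x \<noteq> 0 \<Longrightarrow> - sgn x \<in> unit_sphere n"
  by (auto simp: unit_sphere_iff norm_sgn sgn_div_norm intro!: Esp_closed_intros)

lemma abs_coord_le_norm:
  assumes "x \<in> Esp n"
  shows "\<bar>coord x i\<bar> \<le> norm x"
proof (cases "i < n")
  case True
  have "(coord x i)\<^sup>2 \<le> (\<Sum>j<n. (coord x j)\<^sup>2)"
    using True by (intro member_le_sum) auto
  also have "\<dots> = (norm x)\<^sup>2"
    unfolding power2_norm_eq_inner inner_Esp[OF assms] by (simp add: power2_eq_square)
  finally show ?thesis by (rule abs_le_square_iff[THEN iffD2, of _ "norm x", simplified])
next
  case False
  then show ?thesis using assms by (simp add: Esp_def)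
qed

lift_definition basis_vec :: "nat \<Rightarrow> fseq" is "\<lambda>k i. if i = k then 1 else 0"
  by simp

lemma coord_basis_vec [simp]: "coord (basis_vec k) i = (if i = k then 1 else 0)"
  by transfer simp

text \<open>
  The ambient sequence space is not locally compact, so compactness is built up one coordinate at a
  time: the cube of \<open>Esp (Suc n)\<close> is a continuous image of the cube of \<open>Esp n\<close> times an interval.
\<close>

lemma compact_cube: "compact {x \<in> Esp n. \<forall>i. \<bar>coord x i\<bar> \<le> 1}"
proof (induction n)
  case 0
  have "{x \<in> Esp 0. \<forall>i. \<bar>coord x i\<bar> \<le> 1} \<subseteq> {0}"
    by (auto simp: Esp_def intro: fseq_eqI)
  then show ?case by (meson finite.emptyI finite_imp_compact finite_insert finite_subset)
next
  case (Suc n)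
  let ?C = "\<lambda>n. {x \<in> Esp n. \<forall>i. \<bar>coord x i\<bar> \<le> 1}"
  let ?f = "\<lambda>(x, t). x + t *\<^sub>R basis_vec n"
  have "compact (?f ` (?C n \<times> {-1..1}))"
    by (intro compact_continuous_image compact_Times Suc compact_Icc)
       (auto simp: case_prod_beta intro!: continuous_intros)
  moreover have "?f ` (?C n \<times> {-1..1}) = ?C (Suc n)"
  proof (intro equalityI subsetI)
    fix y assume y: "y \<in> ?C (Suc n)"
    have "\<bar>coord y n\<bar> \<le> 1" using y by simp
    with y show "y \<in> ?f ` (?C n \<times> {-1..1})"
      by (intro image_eqI[of _ _ "(y - coord y n *\<^sub>R basis_vec n, coord y n)"])
         (auto simp: Esp_def abs_le_iff)
  next
    fix y assume "y \<in> ?f ` (?C n \<times> {-1..1})"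
    then obtain x t where *: "x \<in> ?C n" "-1 \<le> t" "t \<le> 1" "y = x + t *\<^sub>R basis_vec n" by auto
    then show "y \<in> ?C (Suc n)" by (auto simp: Esp_def abs_le_iff)
  qed
  ultimately show ?case by simp
qed

lemma compact_unit_ball: "compact (unit_ball n)"
proof -
  have "unit_ball n = {x \<in> Esp n. \<forall>i. \<bar>coord x i\<bar> \<le> 1} \<inter> cball 0 1"
    by (auto simp: unit_ball_def intro: abs_coord_le_norm[THEN order_trans])
  then show ?thesis by (simp add: compact_Int_closed compact_cube)
qed

text \<open>
  Rounding the coordinates to multiples of \<open>1 / q\<close> gives a net of directions. It is larger than an
  optimal net, which has exponential size for fixed distance, but only the logarithm of its
  cardinality matters below.
\<close>

lemma unit_sphere_net:
  assumes "q > 0"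
  obtains W where "finite W" "W \<subseteq> unit_sphere n" "card W \<le> (2 * q + 1) ^ n"
    and "\<And>v. v \<in> unit_sphere n \<Longrightarrow> \<exists>w\<in>W. norm (v - w) \<le> sqrt (real n) / real q"
proof -
  define R where "R v = (\<lambda>i\<in>{..<n}. \<lfloor>coord v i * real q\<rfloor>)" for v
  define rep where "rep g = (SOME v. v \<in> unit_sphere n \<and> R v = g)" for g
  define P where "P = R ` unit_sphere n"
  have P: "P \<subseteq> (\<Pi>\<^sub>E i\<in>{..<n}. {-int q..int q})"
  proof
    fix g assume "g \<in> P"
    then obtain v where v: "v \<in> unit_sphere n" "g = R v" by (auto simp: P_def)
    have "\<lfloor>coord v i * real q\<rfloor> \<in> {-int q..int q}" for i
    proof -
      have "\<bar>coord v i\<bar> \<le> 1" using v abs_coord_le_norm[of v n i] by (auto simp: unit_sphere_iff intro!: Esp_closed_intros)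
      then have "\<bar>coord v i * real q\<bar> \<le> real q"
        by (simp add: abs_mult mult_left_le_one_le)
      then show ?thesis by (simp add: le_floor_iff floor_le_iff abs_le_iff)
    qed
    then show "g \<in> (\<Pi>\<^sub>E i\<in>{..<n}. {-int q..int q})" using v by (auto simp: R_def)
  qed
  have finP: "finite P" by (rule finite_subset[OF P]) (auto intro: finite_PiE)
  have "card P \<le> card (\<Pi>\<^sub>E i\<in>{..<n}. {-int q..int q})"
    by (rule card_mono[OF _ P]) (auto intro: finite_PiE)
  also have "\<dots> = (2 * q + 1) ^ n" by (simp add: card_PiE algebra_simps nat_add_distrib nat_mult_distrib)
  finally have cardP: "card P \<le> (2 * q + 1) ^ n" .
  have rep: "rep g \<in> unit_sphere n \<and> R (rep g) = g" if "g \<in> P" for g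
  proof -
    have "\<exists>v. v \<in> unit_sphere n \<and> R v = g" using that unfolding P_def by blast
    from someI_ex[OF this] show ?thesis unfolding rep_def .
  qed
  show ?thesis
  proof (rule that[of "rep ` P"])
    show "finite (rep ` P)" using finP by simp
    show "rep ` P \<subseteq> unit_sphere n" using rep by auto
    show "card (rep ` P) \<le> (2 * q + 1) ^ n" using card_image_le[OF finP, of rep] cardP by simp
    fix v assume v: "v \<in> unit_sphere n"
    define w where "w = rep (R v)"
    have w: "w \<in> unit_sphere n" "R w = R v" using rep[of "R v"] v by (auto simp: w_def P_def)
    have close: "(coord v i - coord w i)\<^sup>2 \<le> (1 / real q)\<^sup>2" if "i < n" for i
    proof -
      have "\<lfloor>coord w i * real q\<rfloor> = \<lfloor>coord v i * real q\<rfloor>"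
        using fun_cong[OF w(2), of i] that by (simp add: R_def)
      then have "\<bar>coord v i * real q - coord w i * real q\<bar> \<le> 1" by linarith
      then have "\<bar>coord v i - coord w i\<bar> * real q \<le> 1"
        by (simp add: abs_mult left_diff_distrib[symmetric])
      then have "\<bar>coord v i - coord w i\<bar> \<le> \<bar>1 / real q\<bar>"
        using assms by (simp add: field_simps)
      then show ?thesis by (rule abs_le_square_iff[THEN iffD1])
    qed
    have "v - w \<in> Esp n" using v w by (auto simp: unit_sphere_iff intro!: Esp_closed_intros)
    then have "(norm (v - w))\<^sup>2 = (\<Sum>i<n. (coord v i - coord w i)\<^sup>2)"
      unfolding power2_norm_eq_inner by (simp add: inner_Esp power2_eq_square)
    also have "\<dots> \<le> (\<Sum>i<n. (1 / real q)\<^sup>2)" by (intro sum_mono close) simp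
    also have "\<dots> = (sqrt (real n) / real q)\<^sup>2" by (simp add: power_divide)
    finally have "norm (v - w) \<le> sqrt (real n) / real q"
      by (rule power2_le_imp_le) simp
    then show "\<exists>w\<in>rep ` P. norm (v - w) \<le> sqrt (real n) / real q"
      using v by (auto simp: w_def P_def)
  qed
qed

section \<open>Caps and illumination\<close>

lemma cap_iff:
  "z \<in> convex hull (insert x (unit_ball n)) \<longleftrightarrow>
     (\<exists>b\<in>unit_ball n. \<exists>s. 0 \<le> s \<and> s \<le> 1 \<and> z = (1 - s) *\<^sub>R b + s *\<^sub>R x)"
proof -
  have ne: "unit_ball n \<noteq> {}" using zero_in_unit_ball by auto
  have hull: "convex hull (unit_ball n) = unit_ball n" using convex_unit_ball by (simp add: convex_hull_eq)
  show ?thesis (is "?L \<longleftrightarrow> ?R")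
  proof
    assume ?L
    then obtain u b where "0 \<le> u" "u \<le> 1" "b \<in> unit_ball n" "z = (1 - u) *\<^sub>R x + u *\<^sub>R b"
      using ne hull by (auto simp: convex_hull_insert_alt)
    then show ?R by (intro bexI[of _ b] exI[of _ "1 - u"]) (auto simp: add.commute)
  next
    assume ?R
    then obtain s b where "0 \<le> s" "s \<le> 1" "b \<in> unit_ball n" "z = (1 - s) *\<^sub>R b + s *\<^sub>R x"
      by auto
    then show ?L using ne hull
      by (auto simp: convex_hull_insert_alt add.commute intro!: exI[of _ "1 - s"] exI[of _ b])
  qed
qed

lemma compact_cap: "compact (convex hull (insert x (unit_ball n)))"
proof -
  let ?f = "\<lambda>(b, s). (1 - s) *\<^sub>R b + s *\<^sub>R x"
  have "convex hull (insert x (unit_ball n)) = ?f ` (unit_ball n \<times> {0..1})"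
    by (force simp: cap_iff image_iff)
  moreover have "compact (?f ` (unit_ball n \<times> {0..1}))"
    by (intro compact_continuous_image compact_Times compact_unit_ball compact_Icc)
       (auto simp: case_prod_beta intro!: continuous_intros)
  ultimately show ?thesis by simp
qed

lemma compact_spiky_ball: "finite X \<Longrightarrow> compact (spiky_ball n X)"
  by (auto simp: spiky_ball_def intro!: compact_UN compact_cap)

lemma cap_subset_Esp: "x \<in> Esp n \<Longrightarrow> convex hull (insert x (unit_ball n)) \<subseteq> Esp n"
  by (auto simp: cap_iff unit_ball_iff intro!: Esp_closed_intros)

lemma spiky_ball_subset_Esp: "X \<subseteq> Esp n \<Longrightarrow> spiky_ball n X \<subseteq> Esp n"
  unfolding spiky_ball_def using cap_subset_Esp by (intro UN_least) auto

lemma unit_ball_subset_spiky_ball: "X \<noteq> {} \<Longrightarrow> unit_ball n \<subseteq> spiky_ball n X"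
  unfolding spiky_ball_def by (auto intro: hull_inc)

lemma vertices_subset_spiky_ball: "X \<subseteq> spiky_ball n X"
  unfolding spiky_ball_def by (auto intro: hull_inc)

lemma in_Eint_iff:
  assumes "K \<subseteq> Esp n"
  shows "y \<in> Eint n K \<longleftrightarrow> y \<in> Esp n \<and> (\<exists>r>0. Esp n \<inter> ball y r \<subseteq> K)"
proof
  assume "y \<in> Eint n K"
  then obtain T where T: "openin (top_of_set (Esp n)) T" "y \<in> T" "T \<subseteq> K"
    by (auto simp: Eint_def interior_of_def)
  then show "y \<in> Esp n \<and> (\<exists>r>0. Esp n \<inter> ball y r \<subseteq> K)"
    unfolding openin_contains_ball by blast
next
  assume "y \<in> Esp n \<and> (\<exists>r>0. Esp n \<inter> ball y r \<subseteq> K)"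
  then obtain r where "y \<in> Esp n" "r > 0" "Esp n \<inter> ball y r \<subseteq> K" by auto
  then show "y \<in> Eint n K"
    unfolding Eint_def interior_of_def
    by (auto intro!: exI[of _ "Esp n \<inter> ball y r"] simp: openin_open_Int)
qed

lemma Eint_subset: "Eint n K \<subseteq> K"
  by (simp add: Eint_def interior_of_subset)

lemma Ebd_iff:
  assumes "closed K" "K \<subseteq> Esp n"
  shows "x \<in> Ebd n K \<longleftrightarrow> x \<in> K \<and> x \<notin> Eint n K"
proof -
  have "closedin (top_of_set (Esp n)) K" using assms by (simp add: closed_subset)
  then show ?thesis
    by (auto simp: Ebd_def Eint_def frontier_of_def closure_of_closedin)
qed

text \<open>
  By convexity a neighbourhood of the point of the open ball is contracted towards \<open>x\<close> inside \<open>K\<close>, so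
  all points of the half line strictly between \<open>x\<close> and that point are interior to \<open>K\<close>.
\<close>

lemma illuminates_if_hits_open_ball:
  assumes K: "convex K" "unit_ball n \<subseteq> K" "K \<subseteq> Esp n"
    and x: "x \<in> K" and u: "u \<in> unit_sphere n" and t: "t \<ge> 0" and hit: "norm (x + t *\<^sub>R u) < 1"
  shows "illuminates n K u x"
  unfolding illuminates_def
proof (intro allI impI)
  fix \<epsilon> :: real assume \<epsilon>: "\<epsilon> > 0"
  have uE: "u \<in> Esp n" using u by (simp add: unit_sphere_iff)
  define z where "z = x + t *\<^sub>R u"
  define s where "s = min 1 (\<epsilon> / (2 * (norm (t *\<^sub>R u) + 1)))"
  have s: "0 < s" "s \<le> 1" using \<epsilon> by (auto simp: s_def add_nonneg_pos)
  define y where "y = x + (s * t) *\<^sub>R u"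
  have y_eq: "y = (1 - s) *\<^sub>R x + s *\<^sub>R z" by (simp add: y_def z_def algebra_simps)
  have xE: "x \<in> Esp n" using x K by auto
  have zE: "z \<in> Esp n" using xE uE by (auto intro!: Esp_closed_intros simp: z_def)
  have "y \<in> Eint n K"
    unfolding in_Eint_iff[OF K(3)]
  proof (intro conjI exI[of _ "s * (1 - norm z)"])
    show "y \<in> Esp n" using xE uE by (auto intro!: Esp_closed_intros simp: y_def)
    show "s * (1 - norm z) > 0" using s hit by (simp add: z_def)
    show "Esp n \<inter> ball y (s * (1 - norm z)) \<subseteq> K"
    proof
      \<comment> \<open>A point near \<open>y\<close> divides a segment from \<open>x\<close> to a point of the unit ball near \<open>z\<close>.\<close>
      fix y' assume y': "y' \<in> Esp n \<inter> ball y (s * (1 - norm z))"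
      define z' where "z' = z + (1 / s) *\<^sub>R (y' - y)"
      have "norm (y' - y) < s * (1 - norm z)" using y' by (simp add: dist_norm norm_minus_commute)
      then have "norm (y' - y) / s < 1 - norm z" using s by (simp add: field_simps)
      then have "norm z' \<le> 1"
        using norm_triangle_ineq[of z "(1 / s) *\<^sub>R (y' - y)"] s by (simp add: z'_def)
      moreover have "z' \<in> Esp n" using zE y' \<open>y \<in> Esp n\<close> by (auto intro!: Esp_closed_intros simp: z'_def)
      ultimately have "z' \<in> K" using K by (auto simp: unit_ball_iff)
      then have "(1 - s) *\<^sub>R x + s *\<^sub>R z' \<in> K"
        using convexD_alt[OF K(1) x] s by simp
      moreover have "(1 - s) *\<^sub>R x + s *\<^sub>R z' = y'"
        using s by (simp add: z'_def y_eq algebra_simps)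
      ultimately show "y' \<in> K" by simp
    qed
  qed
  moreover have "y \<in> half_line x u" using s t by (auto simp: y_def half_line_def)
  moreover have "dist x y < \<epsilon>"
  proof -
    define N where "N = norm (t *\<^sub>R u)"
    have N: "N \<ge> 0" by (simp add: N_def)
    have "dist x y = s * N" using s t by (simp add: dist_norm y_def N_def)
    also have "\<dots> \<le> (\<epsilon> / (2 * (N + 1))) * N"
      using N by (intro mult_right_mono) (simp_all add: s_def N_def)
    also have "\<dots> < \<epsilon>"
    proof -
      have "\<epsilon> * N < \<epsilon> * (2 * (N + 1))"
        using \<epsilon> N by (intro mult_strict_left_mono) simp_all
      then show ?thesis using N by (simp add: pos_divide_less_eq)
    qed
    finally show ?thesis .
  qed
  ultimately show "\<exists>y\<in>half_line x u \<inter> Eint n K. dist x y < \<epsilon>" by blast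
qed

section \<open>Cap bodies of a given dimension have bounded illumination number\<close>

lemma vertex_notin_other_caps:
  assumes "x \<in> X" "spiky_ball n X \<noteq> spiky_ball n (X - {x})"
  shows "x \<notin> spiky_ball n (X - {x})"
proof
  assume "x \<in> spiky_ball n (X - {x})"
  then obtain z where z: "z \<in> X - {x}" "x \<in> convex hull (insert z (unit_ball n))"
    by (auto simp: spiky_ball_def)
  have "convex hull (insert x (unit_ball n)) \<subseteq> convex hull (insert z (unit_ball n))"
    using z(2) by (intro hull_minimal) (auto intro: hull_inc)
  then have "spiky_ball n X \<subseteq> spiky_ball n (X - {x})"
    using z(1) by (fastforce simp: spiky_ball_def)
  moreover have "spiky_ball n (X - {x}) \<subseteq> spiky_ball n X" by (auto simp: spiky_ball_def)
  ultimately show False using assms by auto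
qed

text \<open>
  Near \<open>v\<close> the segment towards \<open>w\<close> stays in the body by convexity and misses the other caps, which
  form a closed set not containing \<open>v\<close>. So it starts inside the cap of \<open>v\<close>, and the rays from \<open>v\<close>
  into its own cap are those that reach the ball.
\<close>

lemma ray_to_vertex_hits_ball:
  assumes "finite X" "convex (spiky_ball n X)" "v \<in> X" "w \<in> X" "v \<noteq> w"
    and irr: "spiky_ball n X \<noteq> spiky_ball n (X - {v})"
  shows "\<exists>l>0. (1 - l) *\<^sub>R v + l *\<^sub>R w \<in> unit_ball n"
proof -
  let ?C = "spiky_ball n (X - {v})"
  have "closed ?C" using assms(1) by (simp add: compact_imp_closed compact_spiky_ball)
  moreover have "v \<notin> ?C" using vertex_notin_other_caps assms by blast
  ultimately obtain e where e: "e > 0" "ball v e \<subseteq> - ?C"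
    by (metis ComplI open_Compl open_contains_ball)
  define N where "N = norm (w - v)"
  have N: "N > 0" using assms by (simp add: N_def)
  define \<tau> where "\<tau> = min 1 (e / (2 * N))"
  have \<tau>: "0 < \<tau>" "\<tau> \<le> 1" using e N by (auto simp: \<tau>_def)
  define p where "p = (1 - \<tau>) *\<^sub>R v + \<tau> *\<^sub>R w"
  have "p \<in> spiky_ball n X"
    unfolding p_def using assms vertices_subset_spiky_ball \<tau> by (intro convexD_alt) auto
  moreover have "p \<notin> ?C"
  proof -
    have "p - v = \<tau> *\<^sub>R (w - v)" by (simp add: p_def algebra_simps)
    then have "dist v p = \<tau> * N" using \<tau> by (simp add: dist_norm norm_minus_commute[of v] N_def)
    also have "\<dots> \<le> e / (2 * N) * N" using N by (intro mult_right_mono) (auto simp: \<tau>_def)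
    also have "\<dots> < e" using N e by simp
    finally show ?thesis using e by auto
  qed
  ultimately have "p \<in> convex hull (insert v (unit_ball n))"
    by (auto simp: spiky_ball_def)
  then obtain b s where bs: "b \<in> unit_ball n" "0 \<le> s" "s \<le> 1" "p = (1 - s) *\<^sub>R b + s *\<^sub>R v"
    by (auto simp: cap_iff)
  have "s \<noteq> 1"
  proof
    assume "s = 1"
    then have "\<tau> *\<^sub>R (w - v) = 0" using bs by (simp add: p_def algebra_simps)
    then show False using \<tau> assms by simp
  qed
  then have s: "1 - s > 0" using bs by simp
  have "(1 - s) *\<^sub>R b = (1 - s - \<tau>) *\<^sub>R v + \<tau> *\<^sub>R w"
    using bs(4) by (simp add: p_def algebra_simps)
  then have "b = (1 / (1 - s)) *\<^sub>R ((1 - s - \<tau>) *\<^sub>R v + \<tau> *\<^sub>R w)"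
    using s by (metis (no_types, lifting) divide_self_if less_irrefl mult_1 real_vector.scale_one scaleR_scaleR times_divide_eq_left)
  also have "\<dots> = (1 - \<tau> / (1 - s)) *\<^sub>R v + (\<tau> / (1 - s)) *\<^sub>R w"
    using s by (simp add: scaleR_add_right diff_divide_distrib)
  finally show ?thesis using s \<tau> bs(1) by (intro exI[of _ "\<tau> / (1 - s)"]) auto
qed

lemma segment_between_vertices_meets_ball:
  assumes "finite X" "convex (spiky_ball n X)" "v \<in> X" "w \<in> X" "v \<noteq> w"
    and irr: "\<forall>x\<in>X. spiky_ball n X \<noteq> spiky_ball n (X - {x})" and "v \<notin> unit_ball n"
  shows "\<exists>l. 0 \<le> l \<and> l \<le> 1 \<and> norm ((1 - l) *\<^sub>R v + l *\<^sub>R w) \<le> 1"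
proof -
  obtain l where l: "l > 0" "(1 - l) *\<^sub>R v + l *\<^sub>R w \<in> unit_ball n"
    using ray_to_vertex_hits_ball[of X n v w] assms by auto
  obtain m where m: "m > 0" "(1 - m) *\<^sub>R w + m *\<^sub>R v \<in> unit_ball n"
    using ray_to_vertex_hits_ball[of X n w v] assms by auto
  consider "l \<le> 1" | "m \<le> 1" | "l > 1" "m > 1" by linarith
  then show ?thesis
  proof cases
    case 1
    then show ?thesis using l by (intro exI[of _ l]) (auto simp: unit_ball_iff)
  next
    case 2
    then show ?thesis using m by (intro exI[of _ "1 - m"]) (auto simp: unit_ball_iff add.commute)
  next
    \<comment> \<open>Both rays would pass the other vertex before they hit the ball, and \<open>v\<close> would lie between
        two points of the ball.\<close>
    case 3
    define d where "d = l + m - 1"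
    have d: "d > 0" using 3 by (simp add: d_def)
    have "((m - 1) / d) *\<^sub>R ((1 - l) *\<^sub>R v + l *\<^sub>R w) + (l / d) *\<^sub>R ((1 - m) *\<^sub>R w + m *\<^sub>R v)
            \<in> unit_ball n"
      by (rule convexD[OF convex_unit_ball l(2) m(2)])
         (use 3 d in \<open>simp_all add: d_def flip: add_divide_distrib\<close>)
    also have "((m - 1) / d) *\<^sub>R ((1 - l) *\<^sub>R v + l *\<^sub>R w) + (l / d) *\<^sub>R ((1 - m) *\<^sub>R w + m *\<^sub>R v)
            = (((m - 1) * (1 - l) + l * m) / d) *\<^sub>R v + (((m - 1) * l + l * (1 - m)) / d) *\<^sub>R w"
      by (simp add: algebra_simps add_divide_distrib diff_divide_distrib)
    also have "(m - 1) * (1 - l) + l * m = d" by (simp add: d_def algebra_simps)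
    also have "(m - 1) * l + l * (1 - m) = 0" by (simp add: algebra_simps)
    finally show ?thesis using d assms by simp
  qed
qed

text \<open>
  With \<open>a\<close> and \<open>b\<close> the lengths of the two summands, an angle of at most 120 degrees would give the
  sum a squared length of at least \<open>a\<^sup>2 + b\<^sup>2 - a * b \<ge> (a + b)\<^sup>2 / 4 > 1\<close>.
\<close>

lemma long_vectors_obtuse:
  fixes v w :: "'a::real_inner"
  assumes v: "norm v > 2" and w: "norm w > 2" and l: "0 \<le> l" "l \<le> 1"
    and short: "norm ((1 - l) *\<^sub>R v + l *\<^sub>R w) \<le> 1"
  shows "sgn v \<bullet> sgn w < - 1 / 2"
proof (rule ccontr)
  assume "\<not> ?thesis"
  then have c: "sgn v \<bullet> sgn w \<ge> - 1 / 2" by simp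
  define a b where "a = (1 - l) * norm v" and "b = l * norm w"
  have ab: "a \<ge> 0" "b \<ge> 0" using l by (auto simp: a_def b_def)
  have "(1 - l) * norm v + l * norm w > 2"
  proof (cases "l = 0")
    case False
    have "(1 - l) * norm v \<ge> (1 - l) * 2" using l v by (intro mult_left_mono) auto
    moreover have "l * norm w > l * 2" using False l w by (intro mult_strict_left_mono) auto
    ultimately show ?thesis by simp
  qed (use v in simp)
  then have sum: "a + b > 2" by (simp add: a_def b_def)
  have "(1 - l) *\<^sub>R v + l *\<^sub>R w = a *\<^sub>R sgn v + b *\<^sub>R sgn w"
  proof -
    have "norm v *\<^sub>R sgn v = v" "norm w *\<^sub>R sgn w = w" using v w by (auto simp: sgn_div_norm field_simps)
    then show ?thesis by (simp add: a_def b_def flip: scaleR_scaleR)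
  qed
  moreover have "(norm (a *\<^sub>R sgn v + b *\<^sub>R sgn w))\<^sup>2 = a\<^sup>2 + b\<^sup>2 + 2 * (a * b) * (sgn v \<bullet> sgn w)"
  proof -
    have "sgn v \<bullet> sgn v = 1" "sgn w \<bullet> sgn w = 1"
      using v w by (auto simp: norm_sgn simp flip: norm_eq_1)
    then show ?thesis
      unfolding power2_norm_eq_inner
      by (simp add: inner_add_left inner_add_right inner_commute[of "sgn w" "sgn v"] power2_eq_square
          algebra_simps)
  qed
  ultimately have "a\<^sup>2 + b\<^sup>2 + 2 * (a * b) * (sgn v \<bullet> sgn w) \<le> 1"
    using short by (metis norm_ge_zero power_le_one)
  moreover have "2 * (a * b) * (sgn v \<bullet> sgn w) \<ge> 2 * (a * b) * (- 1 / 2)"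
    using ab c by (intro mult_left_mono) auto
  ultimately have "a\<^sup>2 + b\<^sup>2 - a * b \<le> 1" by simp
  moreover have "(a + b)\<^sup>2 > 2\<^sup>2" using sum by (intro power_strict_mono) auto
  moreover have "(a - b)\<^sup>2 \<ge> 0" by simp
  ultimately show False by (simp add: power2_eq_square algebra_simps)
qed

text \<open>The sum of three such unit vectors would have negative squared norm.\<close>

lemma card_le_2_if_pairwise_obtuse:
  fixes L :: "'a::real_inner set"
  assumes "\<And>v w. v \<in> L \<Longrightarrow> w \<in> L \<Longrightarrow> v \<noteq> w \<Longrightarrow> sgn v \<bullet> sgn w < - 1 / 2"
  shows "card L \<le> 2"
proof (rule ccontr)
  assume "\<not> ?thesis"
  then obtain T where T: "T \<subseteq> L" "card T = 3"
    by (metis not_less_eq_eq numeral_2_eq_2 numeral_3_eq_3 obtain_subset_with_card_n)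
  then obtain x y z where xyz: "T = {x, y, z}" "x \<noteq> y" "y \<noteq> z" "x \<noteq> z"
    by (auto simp: card_3_iff)
  have "sgn x \<bullet> sgn y < - 1 / 2" "sgn y \<bullet> sgn z < - 1 / 2" "sgn x \<bullet> sgn z < - 1 / 2"
    using T(1) xyz by (intro assms; auto)+
  moreover have "sgn x \<bullet> sgn x \<le> 1" "sgn y \<bullet> sgn y \<le> 1" "sgn z \<bullet> sgn z \<le> 1"
    by (simp_all add: norm_sgn flip: power2_norm_eq_inner)
  moreover have "0 \<le> sgn x \<bullet> sgn x + sgn y \<bullet> sgn y + sgn z \<bullet> sgn z
        + 2 * (sgn x \<bullet> sgn y + sgn y \<bullet> sgn z + sgn x \<bullet> sgn z)"
    using inner_ge_zero[of "sgn x + sgn y + sgn z"]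
    by (simp add: inner_add_left inner_add_right inner_commute[of "sgn y" "sgn x"]
        inner_commute[of "sgn z" "sgn x"] inner_commute[of "sgn z" "sgn y"])
  ultimately show False by argo
qed

text \<open>
  Points of norm at most 2 see the unit ball under an angle bounded below, so a net of directions
  illuminates all of them. A point of larger norm lies in the cap of a vertex of norm more than 2,
  whose inward direction carries the whole cap outside the ball into the interior, and there are
  at most two such vertices.
\<close>

lemma illumination_number_cap_body_bounded:
  assumes n: "n \<ge> 1"
  shows "\<exists>N. \<forall>K. cap_body n K \<longrightarrow> illumination_number n K \<le> enat N"
proof -
  \<comment> \<open>With net distance \<open>1 / 4\<close>, the ray from a point of norm at most 2 misses the centre by at
      most \<open>1 / 2\<close>.\<close>
  have "4 * n > 0" using n by simp
  then obtain W where W: "finite W" "W \<subseteq> unit_sphere n" "card W \<le> (2 * (4 * n) + 1) ^ n"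
    "\<And>v. v \<in> unit_sphere n \<Longrightarrow> \<exists>w\<in>W. norm (v - w) \<le> sqrt (real n) / real (4 * n)"
    by (rule unit_sphere_net) (rule that)
  have "sqrt (real n) / real (4 * n) \<le> 1 / 4"
  proof -
    have "sqrt (real n) \<le> real n" using n by (intro real_le_lsqrt) (auto simp: power2_eq_square)
    then show ?thesis using n by (simp add: field_simps)
  qed
  with W(4) have net: "\<exists>w\<in>W. norm (v - w) \<le> 1 / 4" if "v \<in> unit_sphere n" for v
    using that by force
  have "illumination_number n K \<le> enat (card W + 2)" if K: "cap_body n K" for K
  proof -
    obtain X where X: "finite X" "X \<noteq> {}" "X \<subseteq> Esp n - unit_ball n"
      "\<forall>x\<in>X. spiky_ball n X \<noteq> spiky_ball n (X - {x})" "K = spiky_ball n X"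
      using K by (auto simp: cap_body_def is_spiky_ball_def)
    have conv: "convex K" and "K \<subseteq> Esp n" and "closed K"
      using K by (auto simp: cap_body_def convex_body_def compact_imp_closed)
    have ball: "unit_ball n \<subseteq> K" using X unit_ball_subset_spiky_ball by simp
    define L where "L = {v \<in> X. norm v > 2}"
    have "card L \<le> 2"
    proof (rule card_le_2_if_pairwise_obtuse)
      fix v w assume vw: "v \<in> L" "w \<in> L" "v \<noteq> w"
      then obtain l where "0 \<le> l" "l \<le> 1" "norm ((1 - l) *\<^sub>R v + l *\<^sub>R w) \<le> 1"
        using segment_between_vertices_meets_ball[of X n v w] X conv by (auto simp: L_def)
      then show "sgn v \<bullet> sgn w < - 1 / 2" using vw by (intro long_vectors_obtuse) (auto simp: L_def)
    qed
    define D where "D = W \<union> (\<lambda>v. - sgn v) ` L"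
    have finL: "finite L" using X by (simp add: L_def)
    have "finite D" using W finL by (simp add: D_def)
    moreover have "D \<subseteq> unit_sphere n"
      using W(2) X(3) by (fastforce simp: D_def L_def intro: minus_sgn_in_unit_sphere)
    moreover have "\<exists>u\<in>D. illuminates n K u x" if x: "x \<in> Ebd n K" for x
    proof (cases "norm x \<le> 2")
      case True
      have xK: "x \<in> K" "x \<notin> Eint n K" using x Ebd_iff \<open>closed K\<close> \<open>K \<subseteq> Esp n\<close> by auto
      then have xE: "x \<in> Esp n" using \<open>K \<subseteq> Esp n\<close> by auto
      have "x \<noteq> 0"
      proof
        assume "x = 0"
        moreover have "0 \<in> Eint n K"
          using ball in_Eint_iff[OF \<open>K \<subseteq> Esp n\<close>, of 0] subspace_0[OF subspace_Esp, of n]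
          by (auto intro!: exI[of _ 1] simp: unit_ball_def subset_iff)
        ultimately show False using xK by simp
      qed
      then have "- sgn x \<in> unit_sphere n"
        using xE by (rule minus_sgn_in_unit_sphere[rotated])
      then obtain w where w: "w \<in> W" "norm (- sgn x - w) \<le> 1 / 4" using net by blast
      have "x + norm x *\<^sub>R w = - (norm x *\<^sub>R (- sgn x - w))"
        using \<open>x \<noteq> 0\<close> by (simp add: sgn_div_norm algebra_simps)
      then have "norm (x + norm x *\<^sub>R w) = norm x * norm (- sgn x - w)"
        by (simp only: norm_minus_cancel norm_scaleR abs_norm_cancel)
      also have "\<dots> \<le> 2 * (1 / 4)" using True w by (intro mult_mono) auto
      finally have "norm (x + norm x *\<^sub>R w) < 1" by simp
      then have "illuminates n K w x"
        using conv ball \<open>K \<subseteq> Esp n\<close> xK w W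
        by (intro illuminates_if_hits_open_ball[where t = "norm x"]) auto
      then show ?thesis using w by (auto simp: D_def)
    next
      case False
      have xK: "x \<in> K" using x Ebd_iff \<open>closed K\<close> \<open>K \<subseteq> Esp n\<close> by auto
      then obtain v where v: "v \<in> X" "x \<in> convex hull (insert v (unit_ball n))"
        using X by (auto simp: spiky_ball_def)
      then obtain b s where bs: "b \<in> unit_ball n" "0 \<le> s" "s \<le> 1" "x = (1 - s) *\<^sub>R b + s *\<^sub>R v"
        by (auto simp: cap_iff)
      have nb: "(1 - s) * norm b \<le> 1 - s"
        using bs by (simp add: unit_ball_iff mult_left_le)
      have "norm x \<le> (1 - s) * norm b + s * norm v"
        using norm_triangle_ineq[of "(1 - s) *\<^sub>R b" "s *\<^sub>R v"] bs by simp
      with nb have nx: "norm x \<le> (1 - s) + s * norm v" by linarith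
      have "norm v > 2"
      proof (rule ccontr)
        assume "\<not> norm v > 2"
        then have "s * norm v \<le> s * 2" using bs by (intro mult_left_mono) auto
        then show False using nx bs False by linarith
      qed
      then have vL: "v \<in> L" using v by (simp add: L_def)
      have "s > 0" using nx False bs by (cases "s = 0") auto
      have "x + (s * norm v) *\<^sub>R (- sgn v) = (1 - s) *\<^sub>R b"
      proof -
        have "norm v *\<^sub>R sgn v = v" using \<open>norm v > 2\<close> by (auto simp: sgn_div_norm field_simps)
        then show ?thesis using bs(4) by (simp flip: scaleR_scaleR)
      qed
      then have "norm (x + (s * norm v) *\<^sub>R (- sgn v)) < 1"
        using nb bs \<open>s > 0\<close> by simp
      then have "illuminates n K (- sgn v) x"
        using conv ball \<open>K \<subseteq> Esp n\<close> xK \<open>D \<subseteq> unit_sphere n\<close> vL bs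
        by (intro illuminates_if_hits_open_ball[where t = "s * norm v"]) (auto simp: D_def)
      then show ?thesis using vL by (auto simp: D_def)
    qed
    ultimately have "D \<in> {D. finite D \<and> D \<subseteq> unit_sphere n \<and>
                  (\<forall>x \<in> Ebd n K. \<exists>u\<in>D. illuminates n K u x)}" by blast
    then have "illumination_number n K \<le> enat (card D)"
      unfolding illumination_number_def by (rule INF_lower)
    also have "card D \<le> card W + 2"
    proof -
      have "card D \<le> card W + card ((\<lambda>v. - sgn v) ` L)" unfolding D_def by (rule card_Un_le)
      also have "card ((\<lambda>v. - sgn v) ` L) \<le> card L" by (rule card_image_le[OF finL])
      finally show ?thesis using \<open>card L \<le> 2\<close> by simp
    qed
    finally show ?thesis by simp
  qed
  then show ?thesis by blast
qed

text \<open>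
  The bound makes the set of values finite; on an infinite set \<open>Max\<close> would be unspecified.
\<close>

lemma illumination_number_le_max:
  assumes "n \<ge> 1" "cap_body n K" "centrally_symmetric n K"
  shows "illumination_number n K \<le> max_illumination_sym_cap n"
proof -
  obtain N where N: "\<forall>K. cap_body n K \<longrightarrow> illumination_number n K \<le> enat N"
    using illumination_number_cap_body_bounded assms(1) by blast
  have "{..enat N} \<subseteq> enat ` {..N}"
  proof
    fix y assume "y \<in> {..enat N}"
    then show "y \<in> enat ` {..N}" by (cases y) auto
  qed
  moreover have "illumination_number n ` {K. cap_body n K \<and> centrally_symmetric n K} \<subseteq> {..enat N}"
    using N by auto
  ultimately have "finite (illumination_number n ` {K. cap_body n K \<and> centrally_symmetric n K})"
    by (intro finite_subset[OF subset_trans finite_imageI[OF finite_atMost]])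
  then show ?thesis unfolding max_illumination_sym_cap_def using assms by (intro Max_ge imageI) simp_all
qed

section \<open>Cap bodies from separated points of the sphere\<close>

lemma capI:
  assumes "a \<in> Esp n" "norm a \<le> 1 - s" "0 \<le> s" "s \<le> 1"
  shows "a + s *\<^sub>R x \<in> convex hull (insert x (unit_ball n))"
proof (cases "s = 1")
  case True
  then show ?thesis using assms by (auto intro: hull_inc)
next
  case False
  then have "(1 / (1 - s)) *\<^sub>R a \<in> unit_ball n"
    using assms by (auto simp: unit_ball_iff divide_simps intro!: Esp_closed_intros)
  then show ?thesis
    unfolding cap_iff using False assms
    by (intro bexI[of _ "(1 / (1 - s)) *\<^sub>R a"] exI[of _ s]) auto
qed

text \<open>
  The distance of the vertices from the centre. From there the ball is seen within 60 degrees of the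
  direction to the centre, and the midpoint of the vertices over \<open>u\<close> and \<open>w\<close>, of squared norm
  \<open>2 / 3 * (1 + u \<bullet> w)\<close>, lies in the ball exactly if \<open>u \<bullet> w \<le> 1 / 2\<close>.
\<close>

definition spike_length :: real where
  "spike_length = 2 / sqrt 3"

lemma spike_length_bounds: "spike_length > 1" "spike_length \<le> 2"
  and spike_length_square: "spike_length\<^sup>2 = 4 / 3"
  by (auto simp: spike_length_def power_divide real_less_lsqrt real_le_rsqrt field_simps)

locale separated_symmetric_points =
  fixes n :: nat and U :: "fseq set"
  assumes finite_U: "finite U" and U_nonempty: "U \<noteq> {}" and U_sphere: "U \<subseteq> unit_sphere n"
    and U_symmetric: "uminus ` U = U"
    and U_separated: "\<And>u w. u \<in> U \<Longrightarrow> w \<in> U \<Longrightarrow> u \<noteq> w \<Longrightarrow> u \<bullet> w \<le> 1 / 2"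
begin

definition vertices :: "fseq set" where
  "vertices = (\<lambda>u. spike_length *\<^sub>R u) ` U"

definition body :: "fseq set" where
  "body = spiky_ball n vertices"

lemma norm_U: "u \<in> U \<Longrightarrow> norm u = 1" and U_Esp: "u \<in> U \<Longrightarrow> u \<in> Esp n"
  using U_sphere by (auto simp: unit_sphere_iff)

lemma in_body_iff:
  "z \<in> body \<longleftrightarrow> (\<exists>u\<in>U. z \<in> convex hull (insert (spike_length *\<^sub>R u) (unit_ball n)))"
  by (auto simp: body_def spiky_ball_def vertices_def)

lemma vertices_subset_Esp: "vertices \<subseteq> Esp n"
  using U_Esp by (auto simp: vertices_def intro!: Esp_closed_intros)

text \<open>
  Among the caps only that of \<open>u\<close> reaches beyond height 1 in direction \<open>u\<close>. This makes each point a
  true vertex and identifies the body with one cap near it.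
\<close>

lemma other_cap_height_le:
  assumes "u \<in> U" "w \<in> U" "u \<noteq> w" "z \<in> convex hull (insert (spike_length *\<^sub>R w) (unit_ball n))"
  shows "u \<bullet> z \<le> 1"
proof -
  obtain b s where bs: "b \<in> unit_ball n" "0 \<le> s" "s \<le> 1" "z = (1 - s) *\<^sub>R b + s *\<^sub>R (spike_length *\<^sub>R w)"
    using assms by (auto simp: cap_iff)
  have "u \<bullet> b \<le> 1"
    using norm_cauchy_schwarz[of u b] norm_U[OF assms(1)] bs by (auto simp: unit_ball_iff)
  moreover have "spike_length * (u \<bullet> w) \<le> 1"
  proof -
    have "spike_length * (u \<bullet> w) \<le> spike_length * (1 / 2)"
      using U_separated assms spike_length_bounds by (intro mult_left_mono) auto
    then show ?thesis using spike_length_bounds(2) by linarith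
  qed
  ultimately have "(1 - s) * (u \<bullet> b) + s * (spike_length * (u \<bullet> w)) \<le> (1 - s) * 1 + s * 1"
    using bs by (intro add_mono mult_left_mono) auto
  then show ?thesis by (simp add: bs(4) inner_add_right)
qed

lemma own_cap_height_le:
  assumes "u \<in> U" "z \<in> convex hull (insert (spike_length *\<^sub>R u) (unit_ball n))"
  shows "u \<bullet> z \<le> spike_length"
proof -
  obtain b s where bs: "b \<in> unit_ball n" "0 \<le> s" "s \<le> 1" "z = (1 - s) *\<^sub>R b + s *\<^sub>R (spike_length *\<^sub>R u)"
    using assms by (auto simp: cap_iff)
  have "u \<bullet> b \<le> spike_length"
    using norm_cauchy_schwarz[of u b] norm_U[OF assms(1)] bs spike_length_bounds(1)
    by (auto simp: unit_ball_iff)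
  then have "(1 - s) * (u \<bullet> b) \<le> (1 - s) * spike_length" using bs by (intro mult_left_mono) auto
  moreover have "u \<bullet> z = (1 - s) * (u \<bullet> b) + s * spike_length"
    using norm_U[OF assms(1)] by (simp add: bs(4) inner_add_right norm_eq_1)
  ultimately show ?thesis by (simp add: left_diff_distrib)
qed

lemma body_height_le:
  assumes "u \<in> U" "z \<in> body"
  shows "u \<bullet> z \<le> spike_length"
proof -
  obtain w where "w \<in> U" "z \<in> convex hull (insert (spike_length *\<^sub>R w) (unit_ball n))"
    using assms in_body_iff by auto
  then show ?thesis
    using own_cap_height_le[of u z] other_cap_height_le[of u w z] assms spike_length_bounds(1)
    by (cases "u = w") auto
qed

lemma inner_vertex: "u \<in> U \<Longrightarrow> u \<bullet> (spike_length *\<^sub>R u) = spike_length"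
  using norm_U[of u] by (simp add: norm_eq_1)

lemma norm_add_separated_le:
  assumes "u \<in> U" "w \<in> U" "u \<noteq> w"
  shows "spike_length * norm (u + w) \<le> 2"
proof -
  have "(norm (u + w))\<^sup>2 = 2 + 2 * (u \<bullet> w)"
    using norm_U assms unfolding power2_norm_eq_inner
    by (simp add: inner_add_left inner_add_right norm_eq_1 inner_commute[of w u])
  also have "\<dots> \<le> 3" using U_separated[OF assms] by simp
  finally have "(spike_length * norm (u + w))\<^sup>2 \<le> 2\<^sup>2"
    by (simp add: power_mult_distrib spike_length_square)
  then show ?thesis by (rule power2_le_imp_le) simp
qed

text \<open>
  A convex combination of two distinct vertices and a point of the ball lies in the cap of the vertex with
  the larger weight: the smaller weight and an equal part of the larger one can be moved to the
  midpoint of the vertices, which belongs to the ball.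
\<close>

lemma combination_in_body_if_weight_ge:
  assumes "u \<in> U" "w \<in> U" and a: "a \<in> Esp n" "norm a \<le> \<alpha>"
    and wt: "0 \<le> \<gamma>" "\<gamma> \<le> \<beta>" "\<alpha> + \<beta> + \<gamma> = 1"
  shows "a + \<beta> *\<^sub>R (spike_length *\<^sub>R u) + \<gamma> *\<^sub>R (spike_length *\<^sub>R w) \<in> body"
proof -
  have "\<alpha> \<ge> 0" using a norm_ge_zero[of a] by linarith
  show ?thesis
  proof (cases "u = w")
    case True
    have "a + (\<beta> + \<gamma>) *\<^sub>R (spike_length *\<^sub>R u) \<in> convex hull (insert (spike_length *\<^sub>R u) (unit_ball n))"
      using a wt \<open>\<alpha> \<ge> 0\<close> by (intro capI) auto
    moreover have "a + \<beta> *\<^sub>R (spike_length *\<^sub>R u) + \<gamma> *\<^sub>R (spike_length *\<^sub>R w) = a + (\<beta> + \<gamma>) *\<^sub>R (spike_length *\<^sub>R u)"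
      using True by (simp only: scaleR_add_left add.assoc)
    ultimately show ?thesis using assms(1) unfolding in_body_iff by metis
  next
    case False
    have "norm (a + (\<gamma> * spike_length) *\<^sub>R (u + w)) \<le> \<alpha> + \<gamma> * (spike_length * norm (u + w))"
      using norm_triangle_ineq[of a "(\<gamma> * spike_length) *\<^sub>R (u + w)"] a wt
        spike_length_bounds(1) by (simp add: abs_mult)
    also have "\<dots> \<le> \<alpha> + \<gamma> * 2"
      using norm_add_separated_le[OF assms(1,2) False] wt by (intro add_left_mono mult_left_mono)
    finally have "norm (a + (\<gamma> * spike_length) *\<^sub>R (u + w)) \<le> 1 - (\<beta> - \<gamma>)" using wt by simp
    then have "a + (\<gamma> * spike_length) *\<^sub>R (u + w) + (\<beta> - \<gamma>) *\<^sub>R (spike_length *\<^sub>R u)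
        \<in> convex hull (insert (spike_length *\<^sub>R u) (unit_ball n))"
      using a wt \<open>\<alpha> \<ge> 0\<close> assms U_Esp by (intro capI) (auto intro!: Esp_closed_intros)
    moreover have "a + (\<gamma> * spike_length) *\<^sub>R (u + w) + (\<beta> - \<gamma>) *\<^sub>R (spike_length *\<^sub>R u)
        = a + \<beta> *\<^sub>R (spike_length *\<^sub>R u) + \<gamma> *\<^sub>R (spike_length *\<^sub>R w)"
      by (simp add: scaleR_add_right scaleR_diff_left left_diff_distrib)
    ultimately show ?thesis using assms(1) unfolding in_body_iff by metis
  qed
qed

lemma convex_body_of_separated: "convex body"
proof (rule convexI)
  fix p q and l m :: real
  assume pq: "p \<in> body" "q \<in> body" and lm: "0 \<le> l" "0 \<le> m" "l + m = 1"
  obtain u b s where p: "u \<in> U" "b \<in> unit_ball n" "0 \<le> s" "s \<le> 1"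
    "p = (1 - s) *\<^sub>R b + s *\<^sub>R (spike_length *\<^sub>R u)"
    using pq(1) by (auto simp: in_body_iff cap_iff)
  obtain w c t where q: "w \<in> U" "c \<in> unit_ball n" "0 \<le> t" "t \<le> 1"
    "q = (1 - t) *\<^sub>R c + t *\<^sub>R (spike_length *\<^sub>R w)"
    using pq(2) by (auto simp: in_body_iff cap_iff)
  define a where "a = (l * (1 - s)) *\<^sub>R b + (m * (1 - t)) *\<^sub>R c"
  have aE: "a \<in> Esp n" using p q by (auto simp: a_def unit_ball_iff intro!: Esp_closed_intros)
  have "norm a \<le> l * (1 - s) * norm b + m * (1 - t) * norm c"
    using norm_triangle_ineq[of "(l * (1 - s)) *\<^sub>R b" "(m * (1 - t)) *\<^sub>R c"] lm p q
    by (simp add: a_def)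
  also have "\<dots> \<le> l * (1 - s) * 1 + m * (1 - t) * 1"
    using lm p q by (intro add_mono mult_left_mono) (auto simp: unit_ball_iff)
  finally have an: "norm a \<le> l * (1 - s) + m * (1 - t)" by simp
  have eq: "l *\<^sub>R p + m *\<^sub>R q = a + (l * s) *\<^sub>R (spike_length *\<^sub>R u) + (m * t) *\<^sub>R (spike_length *\<^sub>R w)"
    unfolding p(5) q(5) a_def by (simp add: scaleR_add_right mult_ac)
  have sum: "l * (1 - s) + m * (1 - t) + l * s + m * t = 1"
    using lm by (simp add: right_diff_distrib)
  have nonneg: "0 \<le> l * s" "0 \<le> m * t" using lm p q by auto
  show "l *\<^sub>R p + m *\<^sub>R q \<in> body"
  proof (cases "m * t \<le> l * s")
    case True
    then show ?thesis unfolding eq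
      using p q aE an nonneg sum by (intro combination_in_body_if_weight_ge)
  next
    case False
    have "a + (m * t) *\<^sub>R (spike_length *\<^sub>R w) + (l * s) *\<^sub>R (spike_length *\<^sub>R u) \<in> body"
      by (rule combination_in_body_if_weight_ge[OF q(1) p(1) aE an]) (use False nonneg sum in auto)
    then show ?thesis unfolding eq by (simp only: add.assoc add.commute[of "(l * s) *\<^sub>R (spike_length *\<^sub>R u)"])
  qed
qed

lemma ball_subset_body: "unit_ball n \<subseteq> body"
  unfolding body_def using U_nonempty by (intro unit_ball_subset_spiky_ball) (simp add: vertices_def)

lemma body_subset_Esp: "body \<subseteq> Esp n"
  unfolding body_def by (rule spiky_ball_subset_Esp[OF vertices_subset_Esp])

lemma compact_body: "compact body"
  unfolding body_def using finite_U by (intro compact_spiky_ball) (simp add: vertices_def)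

lemma cap_body_body: "cap_body n body"
  unfolding cap_body_def
proof
  have "spiky_ball n vertices \<noteq> spiky_ball n (vertices - {x})" if x: "x \<in> vertices" for x
  proof
    assume "spiky_ball n vertices = spiky_ball n (vertices - {x})"
    then have "x \<in> spiky_ball n (vertices - {x})"
      using x vertices_subset_spiky_ball by blast
    then obtain w where w: "w \<in> U" "spike_length *\<^sub>R w \<noteq> x" "x \<in> convex hull (insert (spike_length *\<^sub>R w) (unit_ball n))"
      by (auto simp: spiky_ball_def vertices_def)
    obtain u where u: "u \<in> U" "x = spike_length *\<^sub>R u" using x unfolding vertices_def by blast
    have "u \<bullet> x \<le> 1" using w u by (intro other_cap_height_le[of u w x]) auto
    then show False using inner_vertex[OF u(1)] u spike_length_bounds(1) by simp
  qed
  moreover have "vertices \<subseteq> Esp n - unit_ball n"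
    using vertices_subset_Esp norm_U spike_length_bounds(1) by (auto simp: vertices_def unit_ball_iff)
  moreover have "finite vertices" "vertices \<noteq> {}" using finite_U U_nonempty by (auto simp: vertices_def)
  ultimately show "is_spiky_ball n body"
    unfolding is_spiky_ball_def body_def by blast
  have "0 \<in> Eint n body"
    unfolding in_Eint_iff[OF body_subset_Esp]
    using ball_subset_body zero_in_unit_ball[of n]
    by (intro conjI exI[of _ 1]) (auto simp: unit_ball_def subset_iff)
  then show "convex_body n body"
    unfolding convex_body_def using body_subset_Esp convex_body_of_separated compact_body by blast
qed

lemma centrally_symmetric_body: "centrally_symmetric n body"
proof -
  have sub: "uminus ` body \<subseteq> body"
  proof
    fix y assume "y \<in> uminus ` body"
    then obtain u b s where *: "u \<in> U" "b \<in> unit_ball n" "0 \<le> s" "s \<le> 1"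
      "y = - ((1 - s) *\<^sub>R b + s *\<^sub>R (spike_length *\<^sub>R u))"
      by (auto simp: in_body_iff cap_iff)
    have y: "y = (1 - s) *\<^sub>R (- b) + s *\<^sub>R (spike_length *\<^sub>R (- u))" using * by simp
    have "- b \<in> unit_ball n" using * by (auto simp: unit_ball_iff intro!: Esp_closed_intros)
    moreover have "- u \<in> U" using *(1) U_symmetric by blast
    ultimately show "y \<in> body" unfolding in_body_iff cap_iff using *(3,4) y by blast
  qed
  have "body \<subseteq> uminus ` body"
  proof
    fix y assume "y \<in> body"
    then have "- y \<in> body" using sub by blast
    then show "y \<in> uminus ` body" by (intro image_eqI[of _ _ "- y"]) auto
  qed
  with sub have "uminus ` body = body" by blast
  then show ?thesis
    unfolding centrally_symmetric_def by (intro bexI[of _ 0]) (auto simp: Esp_def)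
qed

lemma vertex_in_body: "u \<in> U \<Longrightarrow> spike_length *\<^sub>R u \<in> body"
  unfolding body_def vertices_def using vertices_subset_spiky_ball by blast

lemma vertex_notin_Eint:
  assumes "u \<in> U"
  shows "spike_length *\<^sub>R u \<notin> Eint n body"
proof
  let ?x = "spike_length *\<^sub>R u"
  assume "?x \<in> Eint n body"
  then obtain e where e: "e > 0" "Esp n \<inter> ball ?x e \<subseteq> body"
    by (auto simp: in_Eint_iff[OF body_subset_Esp])
  let ?y = "?x + (e / 2) *\<^sub>R u"
  have "?y \<in> Esp n \<inter> ball ?x e"
    using U_Esp[OF assms] norm_U[OF assms] e by (auto simp: dist_norm intro!: Esp_closed_intros)
  then have "u \<bullet> ?y \<le> spike_length" using e assms by (intro body_height_le) auto
  moreover have "u \<bullet> ?y = spike_length + e / 2"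
    using inner_vertex[OF assms] norm_U[OF assms] by (simp add: inner_add_right norm_eq_1)
  ultimately show False using e by simp
qed

lemma vertex_in_Ebd:
  assumes "u \<in> U"
  shows "spike_length *\<^sub>R u \<in> Ebd n body"
  using assms vertex_notin_Eint vertex_in_body
  by (simp add: Ebd_iff compact_imp_closed compact_body body_subset_Esp)

text \<open>
  Near a vertex the body coincides with its cap, so an illuminating direction points from the vertex
  to a point of the ball. For \<open>d\<close> the difference of the vertex and that point, the ball condition
  reads \<open>norm d ^ 2 + 1 / 3 \<le> 4 / sqrt 3 * (u \<bullet> d)\<close>, and the left-hand side is at least
  \<open>2 / sqrt 3 * norm d\<close>.
\<close>

lemma direction_illuminating_vertex:
  assumes u: "u \<in> U" and v: "v \<in> unit_sphere n"
    and ill: "illuminates n body v (spike_length *\<^sub>R u)"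
  shows "v \<bullet> u \<le> - 1 / 2"
proof -
  have nu: "norm u = 1" "u \<bullet> u = 1" using norm_U[OF u] by (auto simp: norm_eq_1)
  have nv: "norm v = 1" using v by (simp add: unit_sphere_iff)
  have "spike_length - 1 > 0" using spike_length_bounds by simp
  then obtain y where y: "y \<in> half_line (spike_length *\<^sub>R u) v" "y \<in> Eint n body" "dist (spike_length *\<^sub>R u) y < spike_length - 1"
    using ill unfolding illuminates_def by blast
  obtain t where t: "t \<ge> 0" "y = spike_length *\<^sub>R u + t *\<^sub>R v" using y(1) by (auto simp: half_line_def)
  have "t \<noteq> 0" using t y(2) vertex_notin_Eint[OF u] by auto
  then have t0: "t > 0" using t by simp
  have "y \<in> body" using y(2) Eint_subset by blast
  then obtain w where w: "w \<in> U" "y \<in> convex hull (insert (spike_length *\<^sub>R w) (unit_ball n))"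
    using in_body_iff by auto
  have "\<bar>u \<bullet> (y - spike_length *\<^sub>R u)\<bar> \<le> norm u * norm (y - spike_length *\<^sub>R u)" by (rule Cauchy_Schwarz_ineq2)
  then have "\<bar>u \<bullet> y - spike_length\<bar> < spike_length - 1"
    using y(3) nu by (simp add: dist_norm norm_minus_commute inner_diff_right)
  then have "u \<bullet> y > 1" by linarith
  then have "w = u" using other_cap_height_le[of u w y] u w by fastforce
  then obtain b s where bs: "b \<in> unit_ball n" "0 \<le> s" "s \<le> 1" "y = (1 - s) *\<^sub>R b + s *\<^sub>R (spike_length *\<^sub>R u)"
    using w(2) by (auto simp: cap_iff)
  define d where "d = spike_length *\<^sub>R u - b"
  have tv: "t *\<^sub>R v = - ((1 - s) *\<^sub>R d)"
    using t(2) bs(4) by (simp add: d_def algebra_simps)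
  have t_eq: "t = (1 - s) * norm d"
  proof -
    have "norm (t *\<^sub>R v) = norm ((1 - s) *\<^sub>R d)" unfolding tv by (rule norm_minus_cancel)
    then show ?thesis using t0 nv bs by simp
  qed
  have "(norm (spike_length *\<^sub>R u - d))\<^sup>2 \<le> 1"
    using bs(1) by (simp add: d_def unit_ball_iff power_le_one)
  moreover have "(norm (spike_length *\<^sub>R u - d))\<^sup>2 = spike_length\<^sup>2 - 2 * spike_length * (u \<bullet> d) + (norm d)\<^sup>2"
    unfolding power2_norm_eq_inner
    by (simp add: inner_diff_left inner_diff_right nu inner_commute[of d u] power2_eq_square
        algebra_simps)
  ultimately have ineq: "1 / 3 + (norm d)\<^sup>2 \<le> 2 * spike_length * (u \<bullet> d)"
    using spike_length_square by simp
  have "spike_length * norm d \<le> 1 / 3 + (norm d)\<^sup>2"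
  proof -
    have "0 \<le> (norm d - spike_length / 2)\<^sup>2" by simp
    also have "\<dots> = (norm d)\<^sup>2 - spike_length * norm d + 1 / 3"
      by (simp add: power2_diff power_divide spike_length_square)
    finally show ?thesis by simp
  qed
  with ineq have "spike_length * norm d \<le> spike_length * (2 * (u \<bullet> d))" by (simp add: mult_ac)
  then have "norm d \<le> 2 * (u \<bullet> d)" using spike_length_bounds by (simp add: mult_le_cancel_left)
  then have "(1 - s) * norm d \<le> (1 - s) * (2 * (u \<bullet> d))" using bs by (intro mult_left_mono) auto
  then have "t \<le> 2 * (u \<bullet> ((1 - s) *\<^sub>R d))" using t_eq by simp
  also have "(1 - s) *\<^sub>R d = - (t *\<^sub>R v)" using tv by simp
  finally have "t * 1 \<le> t * (- 2 * (u \<bullet> v))" by simp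
  then have "1 \<le> - 2 * (u \<bullet> v)" using t0 by (simp only: mult_le_cancel_left_pos)
  then show ?thesis by (simp add: inner_commute)
qed

text \<open>Every illuminating set of directions has to illuminate the vertices.\<close>

lemma max_illumination_ge_if_no_small_cover:
  assumes "n \<ge> 1"
    and "\<And>D. D \<subseteq> unit_sphere n \<Longrightarrow> finite D \<Longrightarrow> card D \<le> k \<Longrightarrow> \<exists>u\<in>U. \<forall>v\<in>D. v \<bullet> u > - 1 / 2"
  shows "enat k \<le> max_illumination_sym_cap n"
proof -
  have "enat k \<le> illumination_number n body"
    unfolding illumination_number_def
  proof (rule INF_greatest)
    fix D assume "D \<in> {D. finite D \<and> D \<subseteq> unit_sphere n \<and>
                  (\<forall>x \<in> Ebd n body. \<exists>u\<in>D. illuminates n body u x)}"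
    then have D: "finite D" "D \<subseteq> unit_sphere n"
      "\<And>x. x \<in> Ebd n body \<Longrightarrow> \<exists>u\<in>D. illuminates n body u x" by auto
    have "\<not> card D \<le> k"
    proof
      assume "card D \<le> k"
      then obtain u where u: "u \<in> U" "\<forall>v\<in>D. v \<bullet> u > - 1 / 2" using assms(2)[of D] D by blast
      obtain v where "v \<in> D" "illuminates n body v (spike_length *\<^sub>R u)"
        using D(3)[OF vertex_in_Ebd[OF u(1)]] by blast
      then show False using direction_illuminating_vertex[OF u(1), of v] D(2) u(2) by force
    qed
    then show "enat k \<le> enat (card D)" by simp
  qed
  also have "\<dots> \<le> max_illumination_sym_cap n"
    using illumination_number_le_max[OF assms(1) cap_body_body centrally_symmetric_body] .
  finally show ?thesis .
qed

end

section \<open>Choosing points by halving\<close>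

text \<open>
  Averaging: each set \<open>A d\<close> fills at most a quarter of \<open>S\<close> and \<open>G\<close> at least half of it, so a point
  of \<open>G\<close> lies on average in at most half of the sets.
\<close>

lemma exists_point_in_at_most_half:
  fixes M :: "'a measure" and A :: "'d \<Rightarrow> 'a set"
  assumes S: "S \<in> fmeasurable M" "measure M S > 0" and fin: "finite \<D>"
    and A: "\<And>d. d \<in> \<D> \<Longrightarrow> A d \<in> sets M" "\<And>d. d \<in> \<D> \<Longrightarrow> A d \<subseteq> S"
      "\<And>d. d \<in> \<D> \<Longrightarrow> measure M (A d) \<le> measure M S / 4"
    and G: "G \<in> sets M" "G \<subseteq> S" "measure M G \<ge> measure M S / 2"
  shows "\<exists>x\<in>G. 2 * card {d \<in> \<D>. x \<in> A d} \<le> card \<D>"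
proof (rule ccontr)
  assume contra: "\<not> ?thesis"
  define f :: "'a \<Rightarrow> real" where "f x = (\<Sum>d\<in>\<D>. indicator (A d) x)" for x
  have f_card: "f x = real (card {d \<in> \<D>. x \<in> A d})" for x
    using fin by (simp add: f_def indicator_def sum.If_cases Int_def)
  have Af: "A d \<in> fmeasurable M" if "d \<in> \<D>" for d
    using fmeasurableI2[OF S(1) A(2)[OF that] A(1)[OF that]] .
  have Gf: "G \<in> fmeasurable M" using fmeasurableI2[OF S(1) G(2,1)] .
  have int_A: "integrable M (indicator (A d) :: 'a \<Rightarrow> real)" if "d \<in> \<D>" for d
    using Af[OF that] by (simp add: fmeasurable_def)
  have int_G: "integrable M (indicator G :: 'a \<Rightarrow> real)"
    using Gf by (simp add: fmeasurable_def)
  have "(real (card \<D>) + 1) / 2 * measure M G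
      = (\<integral>x. (real (card \<D>) + 1) / 2 * indicator G x \<partial>M)"
    using G(1) sets.sets_into_space[OF G(1)] by (simp add: Int_absorb2)
  also have "\<dots> \<le> (\<integral>x. f x \<partial>M)"
  proof (rule integral_mono)
    show "integrable M (\<lambda>x. (real (card \<D>) + 1) / 2 * indicator G x)" using int_G by simp
    show "integrable M f" unfolding f_def using int_A by simp
    fix x
    show "(real (card \<D>) + 1) / 2 * indicator G x \<le> f x"
    proof (cases "x \<in> G")
      case True
      then have "card \<D> + 1 \<le> 2 * card {d \<in> \<D>. x \<in> A d}" using contra by force
      then have "real (card \<D> + 1) \<le> real (2 * card {d \<in> \<D>. x \<in> A d})" by (rule of_nat_mono)
      then show ?thesis using True by (simp add: f_card)
    qed (simp add: f_card)
  qed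
  also have "\<dots> = (\<Sum>d\<in>\<D>. \<integral>x. indicator (A d) x \<partial>M)"
    unfolding f_def using int_A by (intro Bochner_Integration.integral_sum) auto
  also have "\<dots> = (\<Sum>d\<in>\<D>. measure M (A d))"
    using A(1) sets.sets_into_space by (intro sum.cong refl) (simp add: Int_absorb2)
  also have "\<dots> \<le> (\<Sum>d\<in>\<D>. measure M S / 4)" by (intro sum_mono A(3))
  finally have "(real (card \<D>) + 1) / 2 * measure M G \<le> real (card \<D>) * (measure M S / 4)"
    by simp
  moreover have "(real (card \<D>) + 1) / 2 * (measure M S / 2) \<le> (real (card \<D>) + 1) / 2 * measure M G"
    using G(3) by (intro mult_left_mono) auto
  ultimately have "(real (card \<D>) + 1) / 2 * (measure M S / 2) \<le> real (card \<D>) * (measure M S / 4)"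
    by linarith
  then show False using S(2) by (simp add: field_simps)
qed

text \<open>
  Think of \<open>Y\<close> as the points chosen so far and of \<open>B x\<close> as the points too close to \<open>x\<close>. Each further
  point can be chosen in at most half of the sets \<open>A d\<close> that contain all earlier ones. These are
  fewer than \<open>2 ^ m\<close>, hence \<open>m\<close> more points are enough, and the bound on \<open>b\<close> keeps half of \<open>S\<close>
  available throughout.
\<close>

lemma exists_separated_set_escaping_family:
  fixes M :: "'a measure" and A :: "'d \<Rightarrow> 'a set" and B :: "'a \<Rightarrow> 'a set"
  assumes S: "S \<in> fmeasurable M" "measure M S > 0"
    and A: "\<And>d. d \<in> \<D> \<Longrightarrow> A d \<in> sets M" "\<And>d. d \<in> \<D> \<Longrightarrow> A d \<subseteq> S"
      "\<And>d. d \<in> \<D> \<Longrightarrow> measure M (A d) \<le> measure M S / 4"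
    and B: "\<And>x. x \<in> S \<Longrightarrow> B x \<in> sets M" "\<And>x. x \<in> S \<Longrightarrow> B x \<subseteq> S"
      "\<And>x. x \<in> S \<Longrightarrow> measure M (B x) \<le> b"
      "\<And>x y. x \<in> S \<Longrightarrow> y \<in> B x \<Longrightarrow> x \<in> B y"
    and fin: "finite \<D>" "card \<D> < 2 ^ m"
    and Y: "finite Y" "Y \<subseteq> S" "pairwise (\<lambda>x y. y \<notin> B x) Y"
    and b: "real (card Y + m) * b \<le> measure M S / 2" "b \<ge> 0"
  shows "\<exists>X. finite X \<and> X \<subseteq> S \<and> pairwise (\<lambda>x y. y \<notin> B x) X \<and> Y \<subseteq> X \<and> (\<forall>d\<in>\<D>. \<exists>x\<in>X. x \<notin> A d)"
  using A fin Y b(1)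
proof (induction m arbitrary: \<D> Y)
  case 0
  then show ?case by (intro exI[of _ Y]) auto
next
  case (Suc m)
  define G where "G = S - (\<Union>y\<in>Y. B y)"
  have BY: "(\<Union>y\<in>Y. B y) \<in> sets M" "(\<Union>y\<in>Y. B y) \<subseteq> S"
    using Suc.prems(6,7) B(1,2) by (auto intro!: sets.finite_UN)
  have G: "G \<in> sets M" "G \<subseteq> S" using BY S(1) by (auto simp: G_def)
  have "measure M (\<Union>y\<in>Y. B y) \<le> (\<Sum>y\<in>Y. measure M (B y))"
    using Suc.prems(6,7) B(1) by (intro measure_UNION_le) auto
  also have "\<dots> \<le> (\<Sum>y\<in>Y. b)" using Suc.prems(7) B(3) by (intro sum_mono) auto
  also have "\<dots> \<le> real (card Y + Suc m) * b" using b(2) by (simp add: mult_right_mono)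
  also have "\<dots> \<le> measure M S / 2" by (rule Suc.prems(9))
  finally have large: "measure M G \<ge> measure M S / 2"
    unfolding G_def using measure_Diff[of M S "\<Union>y\<in>Y. B y"] BY S(1)
    by (auto simp: fmeasurable_def)
  have "\<exists>x\<in>G. 2 * card {d \<in> \<D>. x \<in> A d} \<le> card \<D>"
    by (rule exists_point_in_at_most_half[OF S Suc.prems(4) _ _ _ G large]) (rule Suc.prems; assumption)+
  then obtain x where x: "x \<in> G" "2 * card {d \<in> \<D>. x \<in> A d} \<le> card \<D>"
    by blast
  have xS: "x \<in> S" and xB: "\<And>y. y \<in> Y \<Longrightarrow> x \<notin> B y" using x(1) by (auto simp: G_def)
  define \<E> where "\<E> = {d \<in> \<D>. x \<in> A d}"
  have "\<exists>X. finite X \<and> X \<subseteq> S \<and> pairwise (\<lambda>x y. y \<notin> B x) X \<and> insert x Y \<subseteq> X \<and> (\<forall>d\<in>\<E>. \<exists>x\<in>X. x \<notin> A d)"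
  proof (rule Suc.IH)
    show "card \<E> < 2 ^ m" using x(2) Suc.prems(5) by (simp add: \<E>_def)
    show "pairwise (\<lambda>x y. y \<notin> B x) (insert x Y)"
      using Suc.prems(7,8) xB xS B(4) by (auto simp: pairwise_insert)
    have "card (insert x Y) \<le> Suc (card Y)" by (simp add: card_insert_le_m1 card_insert_if Suc.prems(6))
    then have "real (card (insert x Y) + m) * b \<le> real (card Y + Suc m) * b"
      using b(2) by (intro mult_right_mono) auto
    then show "real (card (insert x Y) + m) * b \<le> measure M S / 2" using Suc.prems(9) by linarith
    show "finite \<E>" "finite (insert x Y)" "insert x Y \<subseteq> S"
      using Suc.prems(4,6,7) xS by (auto simp: \<E>_def)
    fix d assume "d \<in> \<E>"
    then have "d \<in> \<D>" by (simp add: \<E>_def)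
    then show "A d \<in> sets M" "A d \<subseteq> S" "measure M (A d) \<le> measure M S / 4"
      by (fact Suc.prems)+
  qed
  then obtain X where X: "finite X" "X \<subseteq> S" "pairwise (\<lambda>x y. y \<notin> B x) X" "insert x Y \<subseteq> X"
    "\<forall>d\<in>\<E>. \<exists>x\<in>X. x \<notin> A d" by blast
  have "\<exists>x\<in>X. x \<notin> A d" if "d \<in> \<D>" for d
  proof (cases "x \<in> A d")
    case True
    then show ?thesis using that X(5) by (simp add: \<E>_def)
  qed (use X(4) in blast)
  moreover have "Y \<subseteq> X" using X(4) by simp
  ultimately show ?case using X(1,2,3) by (intro exI[of _ X] conjI ballI)
qed

section \<open>Volumes of balls and caps\<close>

text \<open>
  Lebesgue measure on the coordinate space \<open>{..<n} \<rightarrow>\<^sub>E UNIV\<close> stands in for the volume on \<open>Esp n\<close>: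
  as a finite product it is defined for a dimension that is a natural number and not a type.
\<close>

definition vol :: "nat \<Rightarrow> (nat \<Rightarrow> real) measure" where
  "vol n = Pi\<^sub>M {..<n} (\<lambda>_. lborel)"

definition ball_vol :: "nat \<Rightarrow> (nat \<Rightarrow> real) \<Rightarrow> real \<Rightarrow> (nat \<Rightarrow> real) set" where
  "ball_vol n a r = {f \<in> space (vol n). (\<Sum>i<n. (f i - a i)\<^sup>2) \<le> r\<^sup>2}"

interpretation lborel_product: product_sigma_finite "\<lambda>_::nat. lborel :: real measure"
  by standard

lemma space_vol: "space (vol n) = {..<n} \<rightarrow>\<^sub>E UNIV"
  by (simp add: vol_def space_PiM)

lemma coordinate_measurable [measurable]: "i < n \<Longrightarrow> (\<lambda>f. f i) \<in> borel_measurable (vol n)"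
  using measurable_component_singleton[of i "{..<n}" "\<lambda>_. lborel :: real measure"]
  by (simp add: vol_def)

lemma sets_ball_vol [measurable]: "ball_vol n a r \<in> sets (vol n)"
  unfolding ball_vol_def by measurable

lemma emeasure_vol_box:
  "(\<And>i. i < n \<Longrightarrow> A i \<in> sets borel) \<Longrightarrow>
     emeasure (vol n) (Pi\<^sub>E {..<n} A) = (\<Prod>i<n. emeasure lborel (A i))"
  unfolding vol_def by (rule lborel_product.emeasure_PiM) auto

lemma measurable_affine_vol:
  "(\<lambda>f. \<lambda>i\<in>{..<n}. a i + r * f i) \<in> vol n \<rightarrow>\<^sub>M vol n"
proof -
  have "(\<lambda>f. \<lambda>i\<in>{..<n}. a i + r * f i) \<in> vol n \<rightarrow>\<^sub>M Pi\<^sub>M {..<n} (\<lambda>_. lborel)"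
    by (rule measurable_restrict) simp
  then show ?thesis by (simp add: vol_def)
qed

text \<open>
  Homogeneity and translation invariance of the product measure come from the one-dimensional
  statement, since a measure on the product is determined by its values on boxes.
\<close>

lemma vol_affine:
  assumes r: "r > 0"
  shows "vol n = density (distr (vol n) (vol n) (\<lambda>f. \<lambda>i\<in>{..<n}. a i + r * f i)) (\<lambda>_. ennreal (r ^ n))"
    (is "_ = ?P")
proof -
  let ?T = "\<lambda>f. \<lambda>i\<in>{..<n}. a i + r * f i"
  note T = measurable_affine_vol[where n = n and a = a and r = r]
  have "?P = Pi\<^sub>M {..<n} (\<lambda>_. lborel)"
  proof (rule lborel_product.PiM_eqI)
    show "sets ?P = sets (Pi\<^sub>M {..<n} (\<lambda>_. lborel))" by (simp add: vol_def)
    fix A :: "nat \<Rightarrow> real set"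
    assume A: "\<And>i. i \<in> {..<n} \<Longrightarrow> A i \<in> sets lborel"
    define A' where "A' i = (\<lambda>x. a i + r * x) -` A i" for i
    have A': "A' i \<in> sets borel" if "i < n" for i
    proof -
      have "A i \<in> sets borel" using A that by simp
      then show ?thesis unfolding A'_def
        using measurable_sets[of "\<lambda>x. a i + r * x" borel borel "A i"] by simp
    qed
    have box: "Pi\<^sub>E {..<n} A \<in> sets (vol n)"
      unfolding vol_def using A by (intro sets_PiM_I_finite) auto
    have "emeasure ?P (Pi\<^sub>E {..<n} A) = ennreal (r ^ n) * emeasure (vol n) (?T -` Pi\<^sub>E {..<n} A \<inter> space (vol n))"
      using box by (subst emeasure_density_const) (simp_all add: emeasure_distr[OF T box])
    also have "?T -` Pi\<^sub>E {..<n} A \<inter> space (vol n) = Pi\<^sub>E {..<n} A'"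
    proof (intro set_eqI iffI)
      fix f assume "f \<in> ?T -` Pi\<^sub>E {..<n} A \<inter> space (vol n)"
      then have "?T f \<in> Pi\<^sub>E {..<n} A" "f \<in> extensional {..<n}" by (auto simp: space_vol PiE_iff)
      then show "f \<in> Pi\<^sub>E {..<n} A'" by (simp add: PiE_iff A'_def)
    next
      fix f assume f: "f \<in> Pi\<^sub>E {..<n} A'"
      then show "f \<in> ?T -` Pi\<^sub>E {..<n} A \<inter> space (vol n)" by (simp add: PiE_iff A'_def space_vol)
    qed
    also have "ennreal (r ^ n) * emeasure (vol n) (Pi\<^sub>E {..<n} A')
        = (\<Prod>i<n. ennreal r * emeasure lborel (A' i))"
      using A' r by (subst emeasure_vol_box) (auto simp: prod.distrib ennreal_power)
    also have "\<dots> = (\<Prod>i<n. emeasure lborel (A i))"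
    proof (rule prod.cong[OF refl])
      fix i assume "i \<in> {..<n}"
      then have Ai: "A i \<in> sets borel" using A by simp
      have "emeasure lborel (A i)
          = emeasure (density (distr lborel borel (\<lambda>x. a i + r * x)) (\<lambda>_. ennreal \<bar>r\<bar>)) (A i)"
        using lborel_real_affine[of r "a i"] r by simp
      also have "\<dots> = ennreal r * emeasure lborel (A' i)"
        using Ai r by (subst emeasure_density_const) (simp_all add: emeasure_distr A'_def)
      finally show "ennreal r * emeasure lborel (A' i) = emeasure lborel (A i)" ..
    qed
    finally show "emeasure ?P (Pi\<^sub>E {..<n} A) = (\<Prod>i\<in>{..<n}. emeasure lborel (A i))" .
  qed simp
  then show ?thesis by (simp add: vol_def)
qed

lemma emeasure_ball_vol:
  assumes r: "r > 0"
  shows "emeasure (vol n) (ball_vol n a r) = ennreal (r ^ n) * emeasure (vol n) (ball_vol n (\<lambda>_. 0) 1)"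
proof -
  let ?T = "\<lambda>f. \<lambda>i\<in>{..<n}. a i + r * f i"
  note T = measurable_affine_vol[where n = n and a = a and r = r]
  have "emeasure (vol n) (ball_vol n a r)
      = ennreal (r ^ n) * emeasure (vol n) (?T -` ball_vol n a r \<inter> space (vol n))"
    by (subst vol_affine[OF r, of n a], subst emeasure_density_const)
       (simp_all add: emeasure_distr[OF T sets_ball_vol])
  also have "?T -` ball_vol n a r \<inter> space (vol n) = ball_vol n (\<lambda>_. 0) 1"
  proof -
    have sum: "(\<Sum>i<n. (?T f i - a i)\<^sup>2) = r\<^sup>2 * (\<Sum>i<n. (f i - 0)\<^sup>2)" for f
      by (simp add: power_mult_distrib sum_distrib_left)
    have le: "r\<^sup>2 * x \<le> r\<^sup>2 \<longleftrightarrow> x \<le> 1\<^sup>2" for x using r by simp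
    have "?T f \<in> space (vol n)" for f by (simp add: space_vol)
    then show ?thesis unfolding ball_vol_def by (simp only: vimage_def Int_def mem_Collect_eq sum le) blast
  qed
  finally show ?thesis .
qed

lemma emeasure_unit_ball_vol_finite: "emeasure (vol n) (ball_vol n (\<lambda>_. 0) 1) < \<infinity>"
proof -
  have "ball_vol n (\<lambda>_. 0) 1 \<subseteq> Pi\<^sub>E {..<n} (\<lambda>_. {-1..1})"
  proof
    fix f assume f: "f \<in> ball_vol n (\<lambda>_. 0) 1"
    have "f i \<in> {-1..1}" if "i < n" for i
    proof -
      have "(f i)\<^sup>2 \<le> (\<Sum>i<n. (f i)\<^sup>2)" using that by (intro member_le_sum) auto
      then have "(f i)\<^sup>2 \<le> 1" using f by (simp add: ball_vol_def)
      then show ?thesis by (simp add: abs_square_le_1 abs_le_iff)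
    qed
    then show "f \<in> Pi\<^sub>E {..<n} (\<lambda>_. {-1..1})" using f by (auto simp: ball_vol_def space_vol PiE_iff)
  qed
  then have "emeasure (vol n) (ball_vol n (\<lambda>_. 0) 1) \<le> emeasure (vol n) (Pi\<^sub>E {..<n} (\<lambda>_. {-1..1}))"
    by (intro emeasure_mono) (auto simp: vol_def intro!: sets_PiM_I_finite)
  also have "\<dots> = ennreal (2 ^ n)"
    by (subst emeasure_vol_box) (simp_all flip: ennreal_power)
  also have "\<dots> < \<infinity>" by simp
  finally show ?thesis .
qed

lemma ball_vol_fmeasurable:
  assumes "r > 0"
  shows "ball_vol n a r \<in> fmeasurable (vol n)"
  using emeasure_unit_ball_vol_finite[of n] emeasure_ball_vol[OF assms, of n a]
  by (auto simp: fmeasurable_def ennreal_mult_less_top)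

lemma measure_ball_vol:
  assumes "r > 0"
  shows "measure (vol n) (ball_vol n a r) = r ^ n * measure (vol n) (ball_vol n (\<lambda>_. 0) 1)"
  using assms by (simp add: measure_def emeasure_ball_vol[OF assms] enn2real_mult)

lemma measure_unit_ball_vol_pos:
  assumes "n \<ge> 1"
  shows "measure (vol n) (ball_vol n (\<lambda>_. 0) 1) > 0"
proof -
  have sub: "Pi\<^sub>E {..<n} (\<lambda>_. {0..1 / real n}) \<subseteq> ball_vol n (\<lambda>_. 0) 1"
  proof
    fix f assume f: "f \<in> Pi\<^sub>E {..<n} (\<lambda>_. {0..1 / real n})"
    have "(\<Sum>i<n. (f i)\<^sup>2) \<le> (\<Sum>i<n. 1 / real n)"
    proof (rule sum_mono)
      fix i assume "i \<in> {..<n}"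
      then have i: "0 \<le> f i" "f i \<le> 1 / real n" using f by (auto simp: PiE_iff)
      have "1 / real n \<le> 1" using assms by simp
      then have "f i * f i \<le> 1 / real n * 1" using i by (intro mult_mono) auto
      then show "(f i)\<^sup>2 \<le> 1 / real n" by (simp add: power2_eq_square)
    qed
    also have "\<dots> = 1" using assms by simp
    finally show "f \<in> ball_vol n (\<lambda>_. 0) 1" using f by (auto simp: ball_vol_def space_vol PiE_iff)
  qed
  have "0 < ennreal ((1 / real n) ^ n)" using assms by simp
  also have "\<dots> = emeasure (vol n) (Pi\<^sub>E {..<n} (\<lambda>_. {0..1 / real n}))"
    by (subst emeasure_vol_box) (auto simp: ennreal_power)
  also have "\<dots> \<le> emeasure (vol n) (ball_vol n (\<lambda>_. 0) 1)"
    by (intro emeasure_mono sub) simp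
  finally show ?thesis
    using emeasure_unit_ball_vol_finite[of n] by (simp add: measure_def enn2real_positive_iff)
qed

definition cap_vol :: "nat \<Rightarrow> real \<Rightarrow> (nat \<Rightarrow> real) \<Rightarrow> (nat \<Rightarrow> real) set" where
  "cap_vol n c w = {f \<in> ball_vol n (\<lambda>_. 0) 1. c \<le> (\<Sum>i<n. w i * f i)}"

lemma sets_cap_vol [measurable]: "cap_vol n c w \<in> sets (vol n)"
proof -
  have "cap_vol n c w = ball_vol n (\<lambda>_. 0) 1 \<inter> {f \<in> space (vol n). c \<le> (\<Sum>i<n. w i * f i)}"
    by (auto simp: cap_vol_def ball_vol_def)
  then show ?thesis by simp
qed

lemma cap_vol_fmeasurable: "cap_vol n c w \<in> fmeasurable (vol n)"
  by (rule fmeasurableI2[OF ball_vol_fmeasurable[of 1 n "\<lambda>_. 0"]]) (auto simp: cap_vol_def)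

text \<open>
  The part of the unit ball beyond the hyperplane at height \<open>c\<close> lies in a ball of radius
  \<open>sqrt (1 - c\<^sup>2)\<close>, the one centred at the point of the hyperplane closest to the origin.
\<close>

lemma measure_cap_vol_le:
  assumes w: "(\<Sum>i<n. (w i)\<^sup>2) = 1" and c: "0 \<le> c" "c < 1"
  shows "measure (vol n) (cap_vol n c w) \<le> sqrt (1 - c\<^sup>2) ^ n * measure (vol n) (ball_vol n (\<lambda>_. 0) 1)"
proof -
  have c2: "c\<^sup>2 < 1" using c by (simp add: power_less_one_iff abs_square_less_1)
  have sub: "cap_vol n c w \<subseteq> ball_vol n (\<lambda>i. c * w i) (sqrt (1 - c\<^sup>2))"
  proof
    fix f assume f: "f \<in> cap_vol n c w"
    have "(\<Sum>i<n. (f i - c * w i)\<^sup>2)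
        = (\<Sum>i<n. (f i)\<^sup>2) - 2 * c * (\<Sum>i<n. w i * f i) + c\<^sup>2 * (\<Sum>i<n. (w i)\<^sup>2)"
      by (simp add: power2_diff sum.distrib sum_subtractf sum_distrib_left power_mult_distrib mult_ac)
    also have "\<dots> \<le> 1 - 2 * c * c + c\<^sup>2 * 1"
      using f c w by (intro add_mono diff_mono mult_left_mono) (auto simp: cap_vol_def ball_vol_def)
    also have "\<dots> = (sqrt (1 - c\<^sup>2))\<^sup>2" using c2 by (simp add: power2_eq_square)
    finally show "f \<in> ball_vol n (\<lambda>i. c * w i) (sqrt (1 - c\<^sup>2))"
      using f by (auto simp: cap_vol_def ball_vol_def)
  qed
  have pos: "sqrt (1 - c\<^sup>2) > 0" using c2 by simp
  have "measure (vol n) (cap_vol n c w) \<le> measure (vol n) (ball_vol n (\<lambda>i. c * w i) (sqrt (1 - c\<^sup>2)))"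
    by (intro measure_mono_fmeasurable sub ball_vol_fmeasurable pos) simp
  then show ?thesis by (simp add: measure_ball_vol[OF pos])
qed

text \<open>
  A thickened sphere: going from a unit vector to a shell point in the same direction multiplies inner
  products by a factor between \<open>1 - 1 / n\<close> and \<open>1\<close>, and the thickness \<open>1 / n\<close> is enough for the shell
  to contain a fixed part of the ball.
\<close>

definition shell_vol :: "nat \<Rightarrow> (nat \<Rightarrow> real) set" where
  "shell_vol n = {f \<in> ball_vol n (\<lambda>_. 0) 1. (1 - 1 / real n)\<^sup>2 \<le> (\<Sum>i<n. (f i)\<^sup>2)}"

lemma shell_vol_fmeasurable: "shell_vol n \<in> fmeasurable (vol n)"
proof (rule fmeasurableI2[OF ball_vol_fmeasurable[of 1 n "\<lambda>_. 0"]])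
  have "shell_vol n = ball_vol n (\<lambda>_. 0) 1 \<inter> {f \<in> space (vol n). (1 - 1 / real n)\<^sup>2 \<le> (\<Sum>i<n. (f i)\<^sup>2)}"
    by (auto simp: shell_vol_def ball_vol_def)
  then show "shell_vol n \<in> sets (vol n)" by simp
qed (auto simp: shell_vol_def)

text \<open>The ball inside the shell has relative volume \<open>(1 - 1 / n) ^ n \<le> exp (- 1) \<le> 1 / 2\<close>.\<close>

lemma measure_shell_vol_ge:
  assumes "n \<ge> 2"
  shows "measure (vol n) (shell_vol n) \<ge> measure (vol n) (ball_vol n (\<lambda>_. 0) 1) / 2"
proof -
  let ?v = "measure (vol n) (ball_vol n (\<lambda>_. 0) 1)"
  let ?r = "1 - 1 / real n"
  have r: "0 < ?r" using assms by simp
  have r_pow: "?r ^ n \<le> 1 / 2"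
  proof -
    have "?r \<le> exp (- (1 / real n))" using exp_ge_add_one_self[of "- (1 / real n)"] by simp
    then have "?r ^ n \<le> exp (- (1 / real n)) ^ n" using r by (intro power_mono) auto
    also have "\<dots> = exp (- 1)" using assms by (simp flip: exp_of_nat_mult)
    also have "\<dots> \<le> 1 / 2"
      using exp_ge_add_one_self[of 1] by (simp add: exp_minus field_simps)
    finally show ?thesis .
  qed
  have "ball_vol n (\<lambda>_. 0) 1 \<subseteq> ball_vol n (\<lambda>_. 0) ?r \<union> shell_vol n"
    by (auto simp: shell_vol_def ball_vol_def)
  then have "?v \<le> measure (vol n) (ball_vol n (\<lambda>_. 0) ?r \<union> shell_vol n)"
    using r by (intro measure_mono_fmeasurable fmeasurable.Un ball_vol_fmeasurable shell_vol_fmeasurable) auto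
  also have "\<dots> \<le> measure (vol n) (ball_vol n (\<lambda>_. 0) ?r) + measure (vol n) (shell_vol n)"
    using shell_vol_fmeasurable by (intro measure_Un_le) (auto simp: fmeasurable_def)
  also have "measure (vol n) (ball_vol n (\<lambda>_. 0) ?r) = ?r ^ n * ?v" by (rule measure_ball_vol[OF r])
  also have "\<dots> \<le> 1 / 2 * ?v" using r_pow by (intro mult_right_mono) auto
  finally show ?thesis by simp
qed

section \<open>Separated points that few caps cannot cover\<close>

definition of_coords :: "nat \<Rightarrow> (nat \<Rightarrow> real) \<Rightarrow> fseq" where
  "of_coords n f = Abs_fseq (\<lambda>i. if i < n then f i else 0)"

lemma coord_of_coords: "coord (of_coords n f) i = (if i < n then f i else 0)"
proof -
  have "finite {i. (if i < n then f i else 0) \<noteq> 0}"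
    by (rule finite_subset[of _ "{..<n}"]) auto
  then show ?thesis unfolding of_coords_def by (subst Abs_fseq_inverse) auto
qed

lemma of_coords_Esp: "of_coords n f \<in> Esp n"
  by (simp add: Esp_def coord_of_coords)

lemma inner_of_coords: "w \<bullet> of_coords n f = (\<Sum>i<n. coord w i * f i)"
  unfolding inner_commute[of w] inner_Esp[OF of_coords_Esp]
  by (simp add: coord_of_coords mult.commute)

lemma norm_of_coords: "norm (of_coords n f) = sqrt (\<Sum>i<n. (f i)\<^sup>2)"
  by (simp add: norm_eq_sqrt_inner inner_of_coords coord_of_coords power2_eq_square)

lemma norm_of_coords_shell_ge:
  assumes "n \<ge> 1" "f \<in> shell_vol n"
  shows "1 - 1 / real n \<le> norm (of_coords n f)"
  using assms by (auto simp: norm_of_coords shell_vol_def intro!: real_le_rsqrt)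

lemma sum_coord_square_unit_sphere: "w \<in> unit_sphere n \<Longrightarrow> (\<Sum>i<n. (coord w i)\<^sup>2) = 1"
  using inner_Esp[of w n w] by (simp add: unit_sphere_iff norm_eq_1 power2_eq_square)

lemma in_cap_vol_coord_iff:
  "f \<in> cap_vol n c (coord w) \<longleftrightarrow> f \<in> ball_vol n (\<lambda>_. 0) 1 \<and> c \<le> w \<bullet> of_coords n f"
  by (simp add: cap_vol_def inner_of_coords)

text \<open>
  Inner products are compared with the product of the norms, which makes the relation symmetric and
  equivalent to one between the normalised points.
\<close>

definition too_close :: "nat \<Rightarrow> (nat \<Rightarrow> real) \<Rightarrow> (nat \<Rightarrow> real) set" where
  "too_close n f = {g \<in> shell_vol n.
     norm (of_coords n f) * norm (of_coords n g) / 2 < \<bar>of_coords n f \<bullet> of_coords n g\<bar>}"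

lemma sets_too_close: "too_close n f \<in> sets (vol n)"
proof -
  have "too_close n f = shell_vol n \<inter> {g \<in> space (vol n).
      norm (of_coords n f) * sqrt (\<Sum>i<n. (g i)\<^sup>2) / 2 < \<bar>\<Sum>i<n. coord (of_coords n f) i * g i\<bar>}"
    by (auto simp: too_close_def norm_of_coords inner_of_coords shell_vol_def ball_vol_def)
  moreover have "shell_vol n \<in> sets (vol n)" using shell_vol_fmeasurable by blast
  ultimately show ?thesis by simp
qed

text \<open>The points too close to \<open>f\<close> lie in the caps around the direction of \<open>f\<close> and its antipode.\<close>

lemma measure_too_close_le:
  assumes n: "n \<ge> 2" and f: "f \<in> shell_vol n" and c: "0 \<le> c" "c < 1" "c \<le> (1 - 1 / real n) / 2"
  shows "measure (vol n) (too_close n f)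
           \<le> 2 * (sqrt (1 - c\<^sup>2) ^ n * measure (vol n) (ball_vol n (\<lambda>_. 0) 1))"
proof -
  let ?p = "sqrt (1 - c\<^sup>2) ^ n * measure (vol n) (ball_vol n (\<lambda>_. 0) 1)"
  define x where "x = of_coords n f"
  have nx: "norm x > 0"
  proof -
    have "0 < 1 - 1 / real n" using n by simp
    also have "\<dots> \<le> norm x" unfolding x_def using n f by (intro norm_of_coords_shell_ge) simp_all
    finally show ?thesis .
  qed
  have xE: "x \<in> Esp n" by (simp add: x_def of_coords_Esp)
  have "- sgn x \<in> unit_sphere n" using xE nx by (intro minus_sgn_in_unit_sphere) auto
  then have w: "- sgn x \<in> unit_sphere n" "sgn x \<in> unit_sphere n"
    using Esp_closed_intros(4)[of "- sgn x" n] by (auto simp: unit_sphere_iff)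
  have sub: "too_close n f \<subseteq> cap_vol n c (coord (sgn x)) \<union> cap_vol n c (coord (- sgn x))"
  proof
    fix g assume g: "g \<in> too_close n f"
    define y where "y = of_coords n g"
    have gs: "g \<in> shell_vol n" and gt: "norm x * norm y / 2 < \<bar>x \<bullet> y\<bar>"
      using g by (auto simp: too_close_def x_def y_def)
    have "norm y * norm x / 2 < \<bar>x \<bullet> y\<bar>" using gt by (simp add: mult.commute)
    then have "norm y / 2 < \<bar>x \<bullet> y\<bar> / norm x" using nx by (simp add: pos_less_divide_eq)
    also have "\<bar>x \<bullet> y\<bar> / norm x = \<bar>sgn x \<bullet> y\<bar>"
      by (simp add: sgn_div_norm abs_mult divide_inverse mult.commute)
    finally have "norm y / 2 < \<bar>sgn x \<bullet> y\<bar>" .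
    moreover have "c \<le> norm y / 2"
      using norm_of_coords_shell_ge[of n g] n gs c(3) by (simp add: y_def)
    ultimately have "c \<le> sgn x \<bullet> y \<or> c \<le> (- sgn x) \<bullet> y" by (simp add: abs_if split: if_splits)
    moreover have "g \<in> ball_vol n (\<lambda>_. 0) 1" using gs by (simp add: shell_vol_def)
    ultimately show "g \<in> cap_vol n c (coord (sgn x)) \<union> cap_vol n c (coord (- sgn x))"
      unfolding Un_iff in_cap_vol_coord_iff y_def by blast
  qed
  have "measure (vol n) (too_close n f)
      \<le> measure (vol n) (cap_vol n c (coord (sgn x)) \<union> cap_vol n c (coord (- sgn x)))"
    by (intro measure_mono_fmeasurable sub sets_too_close fmeasurable.Un cap_vol_fmeasurable)
  also have "\<dots> \<le> measure (vol n) (cap_vol n c (coord (sgn x))) + measure (vol n) (cap_vol n c (coord (- sgn x)))"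
    by (intro measure_Un_le sets_cap_vol)
  also have "\<dots> \<le> ?p + ?p"
    using w c by (intro add_mono measure_cap_vol_le sum_coord_square_unit_sphere)
  finally show ?thesis by (simp only: mult_2)
qed

lemma basis_vec_in_unit_sphere:
  assumes "k < n"
  shows "basis_vec k \<in> unit_sphere n"
proof -
  have E: "basis_vec k \<in> Esp n" using assms by (auto simp: Esp_def)
  have "basis_vec k \<bullet> basis_vec k = (\<Sum>i<n. if i = k then 1 else 0)"
    unfolding inner_Esp[OF E] by (intro sum.cong) auto
  then show ?thesis using assms E by (simp add: unit_sphere_iff norm_eq_1)
qed

lemma exists_spanning_list:
  assumes "finite D" "card D \<le> k" "D \<subseteq> V" "V \<noteq> {}"
  obtains xs where "length xs = k" "D \<subseteq> set xs" "set xs \<subseteq> V"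
proof -
  obtain ys where ys: "set ys = D" "distinct ys" using finite_distinct_list[OF assms(1)] by blast
  obtain v where v: "v \<in> V" using assms(4) by blast
  have "length ys \<le> k" using ys assms(2) distinct_card by fastforce
  then show ?thesis
    using ys v assms(3) by (intro that[of "ys @ replicate (k - length ys) v"]) (auto simp: set_replicate_conv_if)
qed

text \<open>
  The sets of the family are indexed by the \<open>k\<close>-tuples from a net of directions; there are at most
  \<open>2 ^ (n\<^sup>2 * k)\<close> of them, so \<open>n\<^sup>2 * k + 1\<close> halvings suffice. Passing from a direction to the nearest
  point of the net costs \<open>1 / sqrt n\<close> in the inner product, and passing from the sphere to the shell
  a factor \<open>1 - 1 / n\<close>.
\<close>

lemma exists_separated_points_without_small_cover:
  assumes n: "n \<ge> 3" and c: "0 < c" "c \<le> (1 - 1 / real n) * (1 / 2 - 1 / sqrt (real n))"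
    and small: "(real n ^ 2 * real k + 1) * sqrt (1 - c\<^sup>2) ^ n \<le> 1 / 8"
  obtains U where "finite U" "U \<subseteq> unit_sphere n"
    "\<And>u w. u \<in> U \<Longrightarrow> w \<in> U \<Longrightarrow> u \<noteq> w \<Longrightarrow> \<bar>u \<bullet> w\<bar> \<le> 1 / 2"
    "\<And>D. D \<subseteq> unit_sphere n \<Longrightarrow> finite D \<Longrightarrow> card D \<le> k \<Longrightarrow> \<exists>u\<in>U. \<forall>v\<in>D. v \<bullet> u > - 1 / 2"
proof -
  let ?v = "measure (vol n) (ball_vol n (\<lambda>_. 0) 1)"
  let ?S = "shell_vol n"
  let ?\<mu> = "measure (vol n) ?S"
  define p where "p = sqrt (1 - c\<^sup>2) ^ n"
  have v: "?v > 0" using n by (intro measure_unit_ball_vol_pos) simp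
  have mu: "?\<mu> \<ge> ?v / 2" using n by (intro measure_shell_vol_ge) simp
  have nn: "1 / real n > 0" "1 - 1 / real n > 0" "1 / sqrt (real n) > 0" using n by auto
  have half_pos: "1 / 2 - 1 / sqrt (real n) > 0"
    using c nn by (metis less_le_trans zero_less_mult_pos)
  have "(1 - 1 / real n) * (1 / 2 - 1 / sqrt (real n)) \<le> (1 - 1 / real n) * (1 / 2)"
    using nn by (intro mult_left_mono) auto
  then have c_half: "c \<le> (1 - 1 / real n) / 2" using c(2) by simp
  moreover have "(1 - 1 / real n) / 2 < 1" using n by (simp add: field_simps)
  ultimately have c1: "c < 1" by (rule le_less_trans)
  have c21: "c\<^sup>2 < 1" using c(1) c1 by (simp add: abs_square_less_1)
  have p0: "p \<ge> 0" unfolding p_def using c21 by simp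
  have p_small: "(real n ^ 2 * real k + 1) * p \<le> 1 / 8" using small by (simp add: p_def)

  have "0 < n" using n by simp
  then obtain W where W: "finite W" "W \<subseteq> unit_sphere n" "card W \<le> (2 * n + 1) ^ n"
    "\<And>v. v \<in> unit_sphere n \<Longrightarrow> \<exists>w\<in>W. norm (v - w) \<le> sqrt (real n) / real n"
    by (rule unit_sphere_net) (rule that)
  have "sqrt (real n) / real n = 1 / sqrt (real n)" using n by (simp add: field_simps)
  then have "\<exists>w\<in>W. norm (v - w) \<le> 1 / sqrt (real n)" if "v \<in> unit_sphere n" for v
    using W(4)[OF that] by simp
  then obtain \<nu> where \<nu>: "\<And>v. v \<in> unit_sphere n \<Longrightarrow> \<nu> v \<in> W \<and> norm (v - \<nu> v) \<le> 1 / sqrt (real n)"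
    by metis
  define \<D> where "\<D> = {d. set d \<subseteq> W \<and> length d = k}"
  have fin: "finite \<D>" unfolding \<D>_def by (rule finite_lists_length_eq[OF W(1)])
  have "2 * n + 1 \<le> 2 ^ n"
    using n by (induction n rule: nat_induct_at_least) auto
  then have "card W \<le> (2 ^ n) ^ n" using W(3) by (meson le_trans power_mono zero_le)
  then have "card \<D> \<le> ((2 ^ n) ^ n) ^ k"
    unfolding \<D>_def card_lists_length_eq[OF W(1)] by (intro power_mono) auto
  also have "\<dots> = 2 ^ (n ^ 2 * k)" by (simp add: power_mult power2_eq_square)
  also have "\<dots> < 2 ^ (n ^ 2 * k + 1)" by (intro power_strict_increasing) auto
  finally have card: "card \<D> < 2 ^ (n ^ 2 * k + 1)" .

  define A where "A d = (\<Union>w\<in>set d. cap_vol n c (coord (- w))) \<inter> ?S" for d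
  have Ssets: "?S \<in> sets (vol n)" using shell_vol_fmeasurable by blast
  have A_sets: "A d \<in> sets (vol n)" for d
    unfolding A_def using Ssets by (intro sets.Int sets.finite_UN) auto
  have A_meas: "measure (vol n) (A d) \<le> ?\<mu> / 4" if d: "d \<in> \<D>" for d
  proof -
    have "measure (vol n) (A d) \<le> measure (vol n) (\<Union>w\<in>set d. cap_vol n c (coord (- w)))"
    proof (rule measure_mono_fmeasurable[OF _ A_sets])
      show "A d \<subseteq> (\<Union>w\<in>set d. cap_vol n c (coord (- w)))" unfolding A_def by blast
      show "(\<Union>w\<in>set d. cap_vol n c (coord (- w))) \<in> fmeasurable (vol n)"
        using fmeasurable.finite_Union[of "(\<lambda>w. cap_vol n c (coord (- w))) ` set d" "vol n"] cap_vol_fmeasurable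
        by auto
    qed
    also have "\<dots> \<le> (\<Sum>w\<in>set d. measure (vol n) (cap_vol n c (coord (- w))))"
      by (intro measure_UNION_le) auto
    also have "\<dots> \<le> (\<Sum>w\<in>set d. p * ?v)"
    proof (rule sum_mono)
      fix w assume "w \<in> set d"
      then have "w \<in> unit_sphere n" using d W(2) by (auto simp: \<D>_def)
      then have "- w \<in> unit_sphere n" by (auto simp: unit_sphere_iff intro!: Esp_closed_intros)
      then show "measure (vol n) (cap_vol n c (coord (- w))) \<le> p * ?v"
        unfolding p_def using c c1 by (intro measure_cap_vol_le sum_coord_square_unit_sphere) auto
    qed
    also have "\<dots> = real (card (set d)) * (p * ?v)" by simp
    also have "\<dots> \<le> real k * (p * ?v)"
      using d card_length[of d] p0 v by (intro mult_right_mono) (auto simp: \<D>_def)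
    also have "\<dots> \<le> (real n ^ 2 * real k + 1) * (p * ?v)"
    proof (intro mult_right_mono)
      have "1 * real k \<le> real n ^ 2 * real k" using n by (intro mult_right_mono) auto
      then show "real k \<le> real n ^ 2 * real k + 1" by simp
    qed (use p0 v in auto)
    also have "\<dots> \<le> 1 / 8 * ?v" using mult_right_mono[OF p_small, of ?v] v by (simp add: mult_ac)
    also have "\<dots> \<le> ?\<mu> / 4" using mu by simp
    finally show ?thesis .
  qed

  have "\<exists>X. finite X \<and> X \<subseteq> ?S \<and> pairwise (\<lambda>x y. y \<notin> too_close n x) X \<and> {} \<subseteq> X
      \<and> (\<forall>d\<in>\<D>. \<exists>x\<in>X. x \<notin> A d)"
  proof (rule exists_separated_set_escaping_family)
    show "?S \<in> fmeasurable (vol n)" by (rule shell_vol_fmeasurable)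
    show "?\<mu> > 0" using v mu by linarith
    show "A d \<subseteq> ?S" for d by (simp add: A_def)
    show "measure (vol n) (too_close n x) \<le> 2 * (p * ?v)" if "x \<in> ?S" for x
      unfolding p_def using that n c c1 c_half by (intro measure_too_close_le) auto
    show "too_close n x \<subseteq> ?S" for x by (auto simp: too_close_def)
    show "x \<in> too_close n y" if "x \<in> ?S" "y \<in> too_close n x" for x y
      using that by (simp add: too_close_def inner_commute mult.commute)
    have "(real n ^ 2 * real k + 1) * (2 * (p * ?v)) \<le> ?v / 4"
      using mult_right_mono[OF p_small, of ?v] v by (simp add: mult_ac)
    also have "\<dots> \<le> ?\<mu> / 2" using mu by simp
    finally show "real (card {} + (n ^ 2 * k + 1)) * (2 * (p * ?v)) \<le> ?\<mu> / 2"
      by (simp add: add.commute)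
    show "2 * (p * ?v) \<ge> 0" using p0 v by simp
  qed (use fin card A_sets A_meas sets_too_close in simp_all)
  then obtain X where X: "finite X" "X \<subseteq> ?S" "pairwise (\<lambda>x y. y \<notin> too_close n x) X"
    "\<And>d. d \<in> \<D> \<Longrightarrow> \<exists>x\<in>X. x \<notin> A d" by blast
  define dir where "dir f = sgn (of_coords n f)" for f
  have nonzero: "norm (of_coords n f) > 0" if "f \<in> X" for f
    using norm_of_coords_shell_ge[of n f] that X(2) n nn(2) by force
  have dir_sphere: "dir f \<in> unit_sphere n" if "f \<in> X" for f
    using nonzero[OF that] of_coords_Esp[of n f]
    by (auto simp: dir_def unit_sphere_iff norm_sgn sgn_div_norm intro!: Esp_closed_intros)
  show ?thesis
  proof (rule that[of "dir ` X"])
    show "finite (dir ` X)" using X(1) by simp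
    show "dir ` X \<subseteq> unit_sphere n" using dir_sphere by auto
  next
    fix u w assume uw: "u \<in> dir ` X" "w \<in> dir ` X" "u \<noteq> w"
    then obtain f g where fg: "f \<in> X" "g \<in> X" "u = dir f" "w = dir g" "f \<noteq> g" by auto
    have "g \<notin> too_close n f" using X(3) fg by (auto simp: pairwise_def)
    then have "\<bar>of_coords n f \<bullet> of_coords n g\<bar> \<le> norm (of_coords n f) * norm (of_coords n g) / 2"
      using fg X(2) by (auto simp: too_close_def)
    then show "\<bar>u \<bullet> w\<bar> \<le> 1 / 2"
      using nonzero[OF fg(1)] nonzero[OF fg(2)]
      by (simp add: fg dir_def sgn_div_norm abs_mult field_simps)
  next
    fix D assume D: "D \<subseteq> unit_sphere n" "finite D" "card D \<le> k"
    have "basis_vec 0 \<in> unit_sphere n" using n by (intro basis_vec_in_unit_sphere) simp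
    then obtain xs where xs: "length xs = k" "D \<subseteq> set xs" "set xs \<subseteq> unit_sphere n"
      using exists_spanning_list[OF D(2,3,1)] by blast
    have "map \<nu> xs \<in> \<D>" using xs \<nu> by (auto simp: \<D>_def)
    then obtain f where f: "f \<in> X" "f \<notin> A (map \<nu> xs)" using X(4) by blast
    have fS: "f \<in> ?S" using f X(2) by auto
    have "v \<bullet> dir f > - 1 / 2" if vD: "v \<in> D" for v
    proof (rule ccontr)
      assume "\<not> ?thesis"
      then have far: "1 / 2 \<le> - (v \<bullet> dir f)" by simp
      have vs: "v \<in> unit_sphere n" using vD D by auto
      have "\<bar>(v - \<nu> v) \<bullet> dir f\<bar> \<le> norm (v - \<nu> v) * norm (dir f)" by (rule Cauchy_Schwarz_ineq2)
      also have "\<dots> \<le> 1 / sqrt (real n)"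
        using \<nu>[OF vs] dir_sphere[OF f(1)] by (simp add: unit_sphere_iff)
      finally have near: "1 / 2 - 1 / sqrt (real n) \<le> (- \<nu> v) \<bullet> dir f"
        using far by (simp add: inner_diff_left)
      have "0 \<le> (- \<nu> v) \<bullet> dir f" using half_pos near by (rule order_trans[OF less_imp_le])
      then have "(1 / 2 - 1 / sqrt (real n)) * (1 - 1 / real n)
          \<le> ((- \<nu> v) \<bullet> dir f) * norm (of_coords n f)"
        using near nn norm_of_coords_shell_ge[of n f] fS n by (intro mult_mono) simp_all
      also have "\<dots> = (- \<nu> v) \<bullet> of_coords n f"
        using nonzero[OF f(1)] by (simp add: dir_def sgn_div_norm)
      finally have "c \<le> (- \<nu> v) \<bullet> of_coords n f" using c(2) by (simp add: mult.commute)
      then have "f \<in> cap_vol n c (coord (- \<nu> v))"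
        unfolding in_cap_vol_coord_iff using fS by (simp add: shell_vol_def)
      moreover have "\<nu> v \<in> set (map \<nu> xs)" using vD xs(2) by auto
      ultimately show False using f(2) fS unfolding A_def by blast
    qed
    then show "\<exists>u\<in>dir ` X. \<forall>v\<in>D. v \<bullet> u > - 1 / 2" using f(1) by blast
  qed
qed

section \<open>The asymptotic lower bound\<close>

text \<open>
  Adding the antipodes keeps the points separated because their inner products are bounded in absolute
  value, and it cannot make them easier to cover.
\<close>

lemma max_illumination_ge:
  assumes n: "n \<ge> 3" and c: "0 < c" "c \<le> (1 - 1 / real n) * (1 / 2 - 1 / sqrt (real n))"
    and small: "(real n ^ 2 * real k + 1) * sqrt (1 - c\<^sup>2) ^ n \<le> 1 / 8"
  shows "enat k \<le> max_illumination_sym_cap n"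
proof -
  obtain U where U: "finite U" "U \<subseteq> unit_sphere n"
    "\<And>u w. u \<in> U \<Longrightarrow> w \<in> U \<Longrightarrow> u \<noteq> w \<Longrightarrow> \<bar>u \<bullet> w\<bar> \<le> 1 / 2"
    "\<And>D. D \<subseteq> unit_sphere n \<Longrightarrow> finite D \<Longrightarrow> card D \<le> k \<Longrightarrow> \<exists>u\<in>U. \<forall>v\<in>D. v \<bullet> u > - 1 / 2"
    using assms by (rule exists_separated_points_without_small_cover) (rule that)
  have "U \<noteq> {}" using U(4)[of "{}"] by auto
  interpret separated_symmetric_points n "U \<union> uminus ` U"
  proof
    show "finite (U \<union> uminus ` U)" using U(1) by simp
    show "U \<union> uminus ` U \<noteq> {}" using \<open>U \<noteq> {}\<close> by simp
    show "U \<union> uminus ` U \<subseteq> unit_sphere n"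
      using U(2) by (auto simp: unit_sphere_iff subset_iff intro!: Esp_closed_intros)
    show "uminus ` (U \<union> uminus ` U) = U \<union> uminus ` U"
      by (simp add: image_Un image_image Un_commute)
    have bound: "u \<bullet> w \<le> 1 / 2 \<and> - (u \<bullet> w) \<le> 1 / 2" if "u \<in> U" "w \<in> U" "u \<noteq> w" for u w
      using U(3)[OF that] unfolding abs_le_iff .
    have self: "- (u \<bullet> u) \<le> 1 / 2" for u :: fseq
      by (rule order_trans[of _ 0]) simp_all
    fix u w assume "u \<in> U \<union> uminus ` U" "w \<in> U \<union> uminus ` U" "u \<noteq> w"
    then obtain u' w' where "u' \<in> U" "w' \<in> U" "u = u' \<or> u = - u'" "w = w' \<or> w = - w'" "u \<noteq> w"
      by blast
    then show "u \<bullet> w \<le> 1 / 2"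
      using bound[of u' w'] self[of u'] by (elim disjE; cases "u' = w'") simp_all
  qed
  show ?thesis
  proof (rule max_illumination_ge_if_no_small_cover)
    show "n \<ge> 1" using n by simp
    fix D assume "D \<subseteq> unit_sphere n" "finite D" "card D \<le> k"
    then show "\<exists>u\<in>U \<union> uminus ` U. \<forall>v\<in>D. v \<bullet> u > - 1 / 2" using U(4)[of D] by blast
  qed
qed

text \<open>
  A cap has relative volume about \<open>(sqrt 3 / 2) ^ n\<close>, so \<open>k\<close> of order \<open>q ^ n\<close> leaves room for the
  polynomial factor \<open>n\<^sup>2\<close>, by which the number of chosen points exceeds \<open>k\<close>.
\<close>

lemma eventually_max_illumination_ge_power:
  fixes q :: real
  assumes q: "1 < q" "q < 2 / sqrt 3"
  shows "\<forall>\<^sub>F n in sequentially. \<exists>k. q ^ n \<le> real k \<and> enat k \<le> max_illumination_sym_cap n"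
proof -
  \<comment> \<open>The height \<open>c\<close> is chosen below \<open>1 / 2\<close>, to absorb the losses from net and shell, but so close
      to it that the radius \<open>sqrt (1 - c\<^sup>2)\<close> of the caps stays below \<open>1 / q\<close>.\<close>
  have "q\<^sup>2 < (2 / sqrt 3)\<^sup>2" using q by (intro power_strict_mono) auto
  then have q2: "q\<^sup>2 < 4 / 3" by (simp add: power_divide)
  have q21: "q\<^sup>2 > 1" using q by (simp add: one_less_power)
  define a where "a = ((1 - 1 / q\<^sup>2) + 1 / 4) / 2"
  have "3 / 4 < 1 / y \<and> 1 / y < 1" if "1 < y" "y < 4 / 3" for y :: real
    using that by (simp add: field_simps)
  from this[OF q21 q2] have inv: "3 / 4 < 1 / q\<^sup>2" "1 / q\<^sup>2 < 1" by simp_all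
  have a: "0 < a" "a < 1 / 4" "1 - a < 1 / q\<^sup>2" 
    using inv unfolding a_def by argo+
  define c where "c = sqrt a"
  have c2: "c\<^sup>2 = a" using a by (simp add: c_def)
  have c: "0 < c" using a by (simp add: c_def)
  have c_half: "c < 1 / 2"
    unfolding c_def using a by (intro real_less_lsqrt) (auto simp: power2_eq_square)
  define x where "x = q * sqrt (1 - c\<^sup>2)"
  have x0: "0 < x" using q a by (simp add: x_def c2)
  have "x\<^sup>2 < 1\<^sup>2"
  proof -
    have "x\<^sup>2 = q\<^sup>2 * (1 - a)" using a by (simp add: x_def power_mult_distrib c2)
    also have "\<dots> < q\<^sup>2 * (1 / q\<^sup>2)" using a q21 by (intro mult_strict_left_mono) auto
    also have "\<dots> = 1\<^sup>2" using q by simp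
    finally show ?thesis .
  qed
  then have x1: "x < 1" by (rule power2_less_imp_less) simp
  have "((\<lambda>n. (1 - 1 / real n) * (1 / 2 - 1 / sqrt (real n))) \<longlongrightarrow> 1 / 2) sequentially"
    by real_asymp
  then have ev1: "\<forall>\<^sub>F n in sequentially. c < (1 - 1 / real n) * (1 / 2 - 1 / sqrt (real n))"
    using c_half by (rule order_tendstoD)
  have "((\<lambda>n. 3 * real n ^ 2 * x ^ n) \<longlongrightarrow> 0) sequentially"
    using x0 x1 by real_asymp
  then have ev2: "\<forall>\<^sub>F n in sequentially. 3 * real n ^ 2 * x ^ n < 1 / 8"
    by (rule order_tendstoD) simp
  show ?thesis
    using ev1 ev2 eventually_ge_at_top[of 3]
  proof eventually_elim
    case (elim n)
    define k where "k = nat \<lceil>q ^ n\<rceil>"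
    have qn: "q ^ n \<ge> 1" using q by (intro one_le_power) simp
    have k: "q ^ n \<le> real k" "real k \<le> 2 * q ^ n" unfolding k_def using qn by linarith+
    have "real n ^ 2 \<ge> 1" using elim(3) by (intro one_le_power) simp
    then have "real n ^ 2 * q ^ n \<ge> 1 * 1" using qn by (intro mult_mono) simp_all
    moreover have "real n ^ 2 * real k \<le> real n ^ 2 * (2 * q ^ n)" using k by (intro mult_left_mono) auto
    ultimately have "real n ^ 2 * real k + 1 \<le> 3 * real n ^ 2 * q ^ n" by linarith
    then have "(real n ^ 2 * real k + 1) * sqrt (1 - c\<^sup>2) ^ n \<le> (3 * real n ^ 2 * q ^ n) * sqrt (1 - c\<^sup>2) ^ n"
      using a by (intro mult_right_mono) (auto simp: c2)
    also have "\<dots> = 3 * real n ^ 2 * x ^ n" by (simp add: x_def power_mult_distrib)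
    finally have "(real n ^ 2 * real k + 1) * sqrt (1 - c\<^sup>2) ^ n \<le> 1 / 8" using elim(2) by linarith
    then have "enat k \<le> max_illumination_sym_cap n"
      using elim c by (intro max_illumination_ge) auto
    with k(1) show ?case by blast
  qed
qed

theorem theorem6:
  shows "\<exists>\<epsilon> :: nat \<Rightarrow> real. \<epsilon> \<in> o(\<lambda>_. 1) \<and>
    (\<forall>n\<ge>1. ereal_of_enat (max_illumination_sym_cap n) \<ge> ereal ((2 / sqrt 3 - \<epsilon> n) ^ n))"
proof -
  define s :: real where "s = 2 / sqrt 3"
  have s: "1 < s" "s \<le> 2"
    using spike_length_bounds by (auto simp: s_def spike_length_def)
  \<comment> \<open>The value \<open>2 ^ n\<close> only has to exceed \<open>s ^ n\<close>; it turns an infinite maximum into a real number.\<close>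
  define m where
    "m n = (case max_illumination_sym_cap n of enat k \<Rightarrow> real k | \<infinity> \<Rightarrow> 2 ^ n)" for n
  have m0: "m n \<ge> 0" for n by (simp add: m_def split: enat.split)
  have m_le: "ereal (m n) \<le> ereal_of_enat (max_illumination_sym_cap n)" for n
    by (simp add: m_def split: enat.split)
  define \<epsilon> where "\<epsilon> n = max 0 (s - root n (m n))" for n
  have pow_le: "(s - \<epsilon> n) ^ n \<le> m n" if n: "n \<ge> 1" for n
  proof -
    have "0 \<le> root n (m n)" by (rule real_root_ge_zero[OF m0])
    then have "0 \<le> s - \<epsilon> n" "s - \<epsilon> n \<le> root n (m n)" using s by (auto simp: \<epsilon>_def)
    then have "(s - \<epsilon> n) ^ n \<le> root n (m n) ^ n" by (intro power_mono)
    also have "\<dots> = m n" using n m0 by (simp add: real_root_pow_pos2)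
    finally show ?thesis .
  qed
  have bound: "ereal ((s - \<epsilon> n) ^ n) \<le> ereal_of_enat (max_illumination_sym_cap n)" if "n \<ge> 1" for n
  proof -
    have "ereal ((s - \<epsilon> n) ^ n) \<le> ereal (m n)" using pow_le[OF that] by simp
    also note m_le
    finally show ?thesis .
  qed
  have "\<epsilon> \<longlonglongrightarrow> 0"
  proof (rule tendstoI)
    fix e :: real assume e: "e > 0"
    define q where "q = max (s - e / 2) ((1 + s) / 2)"
    have "s - e / 2 \<le> q" by (simp add: q_def)
    then have q: "1 < q" "q < s" "s - q < e" using e s by (auto simp: q_def less_max_iff_disj)
    have "\<forall>\<^sub>F n in sequentially. \<exists>k. q ^ n \<le> real k \<and> enat k \<le> max_illumination_sym_cap n"
      using q by (intro eventually_max_illumination_ge_power) (auto simp: s_def)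
    then show "\<forall>\<^sub>F n in sequentially. dist (\<epsilon> n) 0 < e"
      using eventually_ge_at_top[of 1]
    proof eventually_elim
      case (elim n)
      have "q ^ n \<le> 2 ^ n" using q s by (intro power_mono) auto
      then have "q ^ n \<le> m n"
        using elim by (auto simp: m_def split: enat.split)
      then have "root n (q ^ n) \<le> root n (m n)" using elim by (intro real_root_le_mono) auto
      then have "q \<le> root n (m n)" using elim q by (simp add: real_root_power_cancel)
      then show ?case using q e by (simp add: \<epsilon>_def)
    qed
  qed
  then have "\<epsilon> \<in> o(\<lambda>_. 1)" by (intro smalloI_tendsto) auto
  with bound show ?thesis unfolding s_def by blast
qed

end
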